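(* For every integer $n\geq 2$, $a_{(n^2-2,n,2)}((n+1)[n]) = 1 + a_{(n^2-2,n,2)}(n[n+1])$.
   Context: For a partition $\lambda$ and positive integers $d,n$, the plethysm coefficient $a_\lambda(d[n])$ is the coefficient of the Schur function $s_\lambda$ in the plethysm $h_d[h_n]$ of complete homogeneous symmetric functions; equivalently, the multiplicity of the irreducible $\mathsf{GL}_m$-representation of highest weight $\lambda$ in $\mathrm{Sym}^d(\mathrm{Sym}^n\mathbb{C}^m)$ for $m$ large. *)

theory Defs
  imports Main "HOL-Library.Multiset" "HOL-Library.Countable_Set"
begin

text \<open>
  A formal power series in the variables \<open>x\<^sub>0, x\<^sub>1, x\<^sub>2, \<dots>\<close> is given by its coefficient function.
  A monomial is the multiset of its variable indices, so that its degree is \<^const>\<open>size\<close> and the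
  product of monomials is the sum of multisets.
\<close>

type_synonym monom = "nat multiset"
type_synonym series = "monom \<Rightarrow> int"

definition hsym :: "nat \<Rightarrow> series" where
  "hsym k = (\<lambda>m. if size m = k then 1 else 0)"

definition is_partition :: "nat list \<Rightarrow> bool" where
  "is_partition l \<longleftrightarrow> sorted_wrt (\<ge>) l \<and> 0 \<notin> set l"

definition young :: "nat list \<Rightarrow> (nat \<times> nat) set" where
  "young l = {(i, j). i < length l \<and> j < l ! i}"

text \<open>
  The entries of a tableau are variable indices, hence start at 0. Outside of the diagram a tableau
  has the dummy value 0, so that distinct functions are distinct tableaux.
\<close>

definition ssyt :: "nat list \<Rightarrow> (nat \<times> nat \<Rightarrow> nat) \<Rightarrow> bool" where
  "ssyt l T \<longleftrightarrow>
     (\<forall>i j j'. (i, j) \<in> young l \<and> (i, j') \<in> young l \<and> j < j' \<longrightarrow> T (i, j) \<le> T (i, j')) \<and>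
     (\<forall>i i' j. (i, j) \<in> young l \<and> (i', j) \<in> young l \<and> i < i' \<longrightarrow> T (i, j) < T (i', j)) \<and>
     (\<forall>p. p \<notin> young l \<longrightarrow> T p = 0)"

definition schur :: "nat list \<Rightarrow> series" where
  "schur l = (\<lambda>m. int (card {T. ssyt l T \<and> image_mset T (mset_set (young l)) = m}))"

text \<open>
  Plethysm \<open>f[g]\<close> for a symmetric function \<open>f\<close> and a symmetric function \<open>g\<close> that has nonnegative
  integer coefficients and no constant term: write \<open>g = y\<^sub>0 + y\<^sub>1 + \<dots>\<close> as a sum of monomials, each
  repeated according to its coefficient, and put \<open>f[g] = f(y\<^sub>0, y\<^sub>1, \<dots>)\<close>. The pair \<open>(m, j)\<close> stands
  for the \<open>j\<close>-th copy of the monomial \<open>m\<close>; the order in which \<^const>\<open>to_nat_on\<close> enumerates the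
  copies is irrelevant because \<open>f\<close> is symmetric. The sum below ranges over the monomials \<open>B\<close> in the
  variables \<open>y\<close> which become \<open>m\<close> after the substitution; there are finitely many of them because
  \<open>g\<close> has no constant term.
\<close>

definition monomial_copies :: "series \<Rightarrow> (monom \<times> nat) set" where
  "monomial_copies g = {(m, j). int j < g m}"

definition plethysm :: "series \<Rightarrow> series \<Rightarrow> series" where
  "plethysm f g = (\<lambda>m.
     \<Sum>B | set_mset B \<subseteq> monomial_copies g \<and> (\<Sum>y\<in>#B. fst y) = m.
       f (image_mset (to_nat_on (monomial_copies g)) B))"

definition schur_expansion :: "series \<Rightarrow> (nat list \<Rightarrow> int) \<Rightarrow> bool" where
  "schur_expansion f c \<longleftrightarrow>
     finite {l. c l \<noteq> 0} \<and> (\<forall>l. c l \<noteq> 0 \<longrightarrow> is_partition l) \<and>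
     f = (\<lambda>m. \<Sum>l | c l \<noteq> 0. c l * schur l m)"

text \<open>
  The Schur functions form a basis of the ring of symmetric functions, so every symmetric function
  has exactly one expansion.
\<close>

definition schur_coeff :: "series \<Rightarrow> nat list \<Rightarrow> int" where
  "schur_coeff f = (THE c. schur_expansion f c)"

definition plethysm_coeff :: "nat list \<Rightarrow> nat \<Rightarrow> nat \<Rightarrow> int" where
  "plethysm_coeff l d n = schur_coeff (plethysm (hsym d) (hsym n)) l"

end

theory Submission
  imports Defs "HOL-Library.List_Lexorder" "HOL-Combinatorics.Transposition"
begin

text \<open>
  The coefficient of \<open>s\<^bsub>(p,q,r)\<^esub>\<close> in a symmetric function \<open>f\<close> is the alternating sum, over the
  permutations of \<open>\<rho> = (2,1,0)\<close>, of the coefficients of \<open>f\<close> at \<open>x\<^sup>\<alpha>\<close> with \<open>\<alpha> = (p,q,r) + \<rho> - w\<rho>\<close>.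
  The coefficient of \<open>x\<^sub>0\<^sup>ax\<^sub>1\<^sup>px\<^sub>2\<^sup>q\<close> in \<open>h\<^sub>d[h\<^sub>n]\<close> counts the multisets of at most \<open>d\<close> nonconstant
  monomials in \<open>x\<^sub>1, x\<^sub>2\<close> of degree at most \<open>n\<close> with product \<open>x\<^sub>1\<^sup>px\<^sub>2\<^sup>q\<close>. Comparing the bounds
  \<open>(n+1, n)\<close> and \<open>(n, n+1)\<close> with \<open>(n+1, n+1)\<close>, the two counts differ by the number of multisets with
  exactly \<open>n+1\<close> parts minus the number of those with a part of degree \<open>n+1\<close>. All six terms have
  \<open>p + q \<le> n + 2\<close>, so these multisets are nearly determined: the difference vanishes for
  \<open>p + q \<le> n + 1\<close>, and for \<open>p + q = n + 2\<close> it is the number of quadratic divisors of \<open>x\<^sub>1\<^sup>px\<^sub>2\<^sup>q\<close> minus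
  the number of its linear ones. This gives \<open>3 - 2\<close> for \<open>x\<^sub>1\<^sup>nx\<^sub>2\<^sup>2\<close> and \<open>2 - 2\<close> for \<open>x\<^sub>1\<^sup>n\<^sup>+\<^sup>1x\<^sub>2\<close>.
\<close>

section \<open>Gelfand-Tsetlin patterns\<close>

text \<open>Padding with zeros lets the interlacing conditions be stated without reference to the
  length of the partition.\<close>

definition row :: "nat list \<Rightarrow> nat \<Rightarrow> nat" where
  "row l i = (if i < length l then l ! i else 0)"

lemma mem_young [simp]: "(i, j) \<in> young l \<longleftrightarrow> j < row l i"
  by (auto simp: young_def row_def)

lemma row_antimono:
  assumes "is_partition l" "i \<le> i'"
  shows "row l i' \<le> row l i"
  using assms unfolding is_partition_def row_def
  by (auto simp: sorted_wrt_iff_nth_less le_less)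

lemma finite_young: "finite (young l)"
proof -
  have "young l = (SIGMA i:{..<length l}. {..<l ! i})"
    by (auto simp: young_def)
  then show ?thesis by simp
qed

text \<open>
  \<open>g k i\<close> is the number of entries less than \<open>k\<close> in row \<open>i\<close> of a tableau of shape \<open>l\<close>.
\<close>

definition gt_pattern :: "nat list \<Rightarrow> (nat \<Rightarrow> nat \<Rightarrow> nat) \<Rightarrow> bool" where
  "gt_pattern l g \<longleftrightarrow>
     (\<forall>i. g 0 i = 0) \<and> (\<forall>k i. g k i \<le> g (Suc k) i) \<and> (\<forall>k i. g (Suc k) (Suc i) \<le> g k i) \<and>
     (\<forall>k i. g k i \<le> row l i) \<and> (\<exists>k. \<forall>i. g k i = row l i)"

definition level_sum :: "nat list \<Rightarrow> (nat \<Rightarrow> nat \<Rightarrow> nat) \<Rightarrow> nat \<Rightarrow> nat" where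
  "level_sum l g k = (\<Sum>i<length l. g k i)"

definition gt_patterns :: "nat list \<Rightarrow> monom \<Rightarrow> (nat \<Rightarrow> nat \<Rightarrow> nat) set" where
  "gt_patterns l m =
     {g. gt_pattern l g \<and> (\<forall>k. level_sum l g (Suc k) = level_sum l g k + count m k)}"

definition gt_of_tableau :: "nat list \<Rightarrow> (nat \<times> nat \<Rightarrow> nat) \<Rightarrow> nat \<Rightarrow> nat \<Rightarrow> nat" where
  "gt_of_tableau l T k i = card {j. j < row l i \<and> T (i, j) < k}"

text \<open>As \<open>g k i\<close> counts the entries less than \<open>k\<close>, the entry in
  column \<open>j\<close> is the \<open>k\<close> for which the count first exceeds \<open>j\<close>
  at level \<open>Suc k\<close>.\<close>

definition tableau_of_gt :: "nat list \<Rightarrow> (nat \<Rightarrow> nat \<Rightarrow> nat) \<Rightarrow> nat \<times> nat \<Rightarrow> nat" where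
  "tableau_of_gt l g = (\<lambda>(i, j). if j < row l i then LEAST k. j < g (Suc k) i else 0)"

lemma down_closed_eq_lessThan_card:
  fixes A :: "nat set"
  assumes "finite A" "\<And>a b. b \<in> A \<Longrightarrow> a < b \<Longrightarrow> a \<in> A"
  shows "A = {..<card A}"
proof (cases "A = {}")
  case False
  then have "Max A \<in> A" "x \<le> Max A" if "x \<in> A" for x
    using assms(1) that by auto
  with assms(2) False have "A = {..Max A}" by (force simp: le_less)
  then have "A = {..<Suc (Max A)}" by (simp add: lessThan_Suc_atMost)
  then show ?thesis by (metis card_lessThan)
qed simp

text \<open>Rows increase weakly, so the entries less than \<open>k\<close> fill an initial segment
  of the row. This equivalence and its mirror \<open>less_tableau_of_gt_iff\<close> carry both
  directions of the bijection.\<close>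

lemma less_gt_of_tableau_iff:
  assumes "ssyt l T"
  shows "j < gt_of_tableau l T k i \<longleftrightarrow> j < row l i \<and> T (i, j) < k"
proof -
  let ?A = "{j. j < row l i \<and> T (i, j) < k}"
  have "?A = {..<card ?A}"
  proof (rule down_closed_eq_lessThan_card)
    show "finite ?A" by simp
    fix a b assume *: "b \<in> ?A" "a < b"
    then have "T (i, a) \<le> T (i, b)"
      using assms unfolding ssyt_def by fastforce
    with * show "a \<in> ?A" by auto
  qed
  then show ?thesis unfolding gt_of_tableau_def by blast
qed

lemma gt_pattern_mono:
  assumes "gt_pattern l g" "k \<le> k'"
  shows "g k i \<le> g k' i"
  using assms(2)
proof (induction rule: dec_induct)
  case (step k')
  have "g k' i \<le> g (Suc k') i" using assms(1) by (auto simp: gt_pattern_def)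
  with step.IH show ?case by (rule le_trans)
qed simp

lemma gt_pattern_eventually:
  assumes "gt_pattern l g"
  obtains K where "\<And>k i. k \<ge> K \<Longrightarrow> g k i = row l i"
proof -
  obtain K where "\<And>i. g K i = row l i" using assms by (auto simp: gt_pattern_def)
  moreover have "g k i \<le> row l i" for k i using assms by (auto simp: gt_pattern_def)
  ultimately show ?thesis
    using that[of K] gt_pattern_mono[OF assms, of K] by (metis le_antisym)
qed

lemma less_tableau_of_gt_iff:
  assumes "gt_pattern l g"
  shows "j < row l i \<and> tableau_of_gt l g (i, j) < k \<longleftrightarrow> j < g k i"
proof (cases "j < row l i")
  case True
  let ?t = "tableau_of_gt l g (i, j)"
  have t: "?t = (LEAST k. j < g (Suc k) i)" using True by (simp add: tableau_of_gt_def)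
  obtain K where "\<And>k i. k \<ge> K \<Longrightarrow> g k i = row l i" using gt_pattern_eventually[OF assms] by blast
  then have "j < g (Suc K) i" using True by simp
  then have j: "j < g (Suc ?t) i" unfolding t by (rule LeastI)
  show ?thesis
  proof
    assume "j < row l i \<and> ?t < k"
    then show "j < g k i" using gt_pattern_mono[OF assms, of "Suc ?t" k i] j by auto
  next
    assume k: "j < g k i"
    then obtain k' where "k = Suc k'" using assms by (cases k) (auto simp: gt_pattern_def)
    with k True show "j < row l i \<and> ?t < k" unfolding t by (auto simp: less_Suc_eq_le intro: Least_le)
  qed
next
  case False
  have "g k i \<le> row l i" using assms by (auto simp: gt_pattern_def)
  with False show ?thesis by auto
qed

lemma nat_leI_less: "(\<And>j::nat. j < a \<Longrightarrow> j < b) \<Longrightarrow> a \<le> b"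
  by (meson leI less_irrefl)

lemma gt_pattern_of_tableau:
  assumes "is_partition l" and T: "ssyt l T"
  shows "gt_pattern l (gt_of_tableau l T)"
proof -
  note iff = less_gt_of_tableau_iff[OF T]
  have "gt_of_tableau l T 0 i = 0" for i using iff[of 0 0 i] by simp
  moreover have "gt_of_tableau l T k i \<le> gt_of_tableau l T (Suc k) i" for k i
    by (rule nat_leI_less) (auto simp: iff)
  \<comment> \<open>Column strictness: an entry less than \<open>Suc k\<close> in row
    \<open>Suc i\<close> has an entry less than \<open>k\<close> above it.\<close>
  moreover have "gt_of_tableau l T (Suc k) (Suc i) \<le> gt_of_tableau l T k i" for k i
  proof (rule nat_leI_less)
    fix j assume *: "j < gt_of_tableau l T (Suc k) (Suc i)"
    then have "j < row l i" using row_antimono[OF assms(1), of i "Suc i"] by (auto simp: iff)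
    moreover from this * have "T (i, j) < T (Suc i, j)"
      using T unfolding ssyt_def by (auto simp: iff)
    ultimately show "j < gt_of_tableau l T k i" using * by (auto simp: iff)
  qed
  moreover have "gt_of_tableau l T k i \<le> row l i" for k i
    by (rule nat_leI_less) (auto simp: iff)
  moreover have "\<exists>k. \<forall>i. gt_of_tableau l T k i = row l i"
  proof -
    have "T p \<le> Max (T ` young l)" if "p \<in> young l" for p
      using that finite_young by (intro Max_ge) auto
    then have "row l i \<le> gt_of_tableau l T (Suc (Max (T ` young l))) i" for i
      by (intro nat_leI_less) (auto simp: iff less_Suc_eq_le)
    moreover have "gt_of_tableau l T k i \<le> row l i" for k i
      by (rule nat_leI_less) (auto simp: iff)
    ultimately show ?thesis by (metis le_antisym)
  qed
  ultimately show ?thesis unfolding gt_pattern_def by blast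
qed

lemma ssyt_tableau_of_gt:
  assumes "is_partition l" and g: "gt_pattern l g"
  shows "ssyt l (tableau_of_gt l g)"
proof -
  let ?T = "tableau_of_gt l g"
  note iff = less_tableau_of_gt_iff[OF g]
  have row: "?T (i, j) \<le> ?T (i, j')" if "j' < row l i" "j < j'" for i j j'
    using iff[of j' i "Suc (?T (i, j'))"] iff[of j i "Suc (?T (i, j'))"] that by auto
  have step: "?T (i, j) < ?T (Suc i, j)" if "j < row l (Suc i)" for i j
  proof -
    have "j < g (Suc (?T (Suc i, j))) (Suc i)"
      using iff[of j "Suc i" "Suc (?T (Suc i, j))"] that by auto
    also have "\<dots> \<le> g (?T (Suc i, j)) i" using g by (auto simp: gt_pattern_def)
    finally show ?thesis using iff by blast
  qed
  \<comment> \<open>Adjacent rows suffice: the intermediate cells of the column exist because the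
    row lengths decrease weakly.\<close>
  have col: "?T (i, j) < ?T (i', j)" if "j < row l i'" "i < i'" for i i' j
    using that(2,1)
  proof (induction rule: less_Suc_induct)
    case (2 a b c)
    then show ?case using row_antimono[OF assms(1), of b c] by force
  qed (rule step)
  have "?T p = 0" if "p \<notin> young l" for p
    using that by (cases p) (auto simp: tableau_of_gt_def)
  with row col show ?thesis unfolding ssyt_def by simp
qed

text \<open>Passing from level \<open>k\<close> to level \<open>Suc k\<close> adds exactly the cells
  with entry \<open>k\<close>, so the weight of a tableau is the sequence of differences of its
  level sums.\<close>

lemma weight_iff:
  assumes "ssyt l T"
  shows "image_mset T (mset_set (young l)) = m \<longleftrightarrow>
    (\<forall>k. level_sum l (gt_of_tableau l T) (Suc k) = level_sum l (gt_of_tableau l T) k + count m k)"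
proof -
  have "level_sum l (gt_of_tableau l T) (Suc k) =
      level_sum l (gt_of_tableau l T) k + count (image_mset T (mset_set (young l))) k" for k
  proof -
    let ?A = "\<lambda>i. {j. j < row l i \<and> T (i, j) = k}"
    have "{p \<in> young l. T p = k} = (SIGMA i:{..<length l}. ?A i)"
      by (auto simp: row_def split: if_splits)
    then have "card {p \<in> young l. T p = k} = (\<Sum>i<length l. card (?A i))"
      by simp
    moreover have "count (image_mset T (mset_set (young l))) k = card {p \<in> young l. T p = k}"
      using finite_young[of l]
      by (simp add: count_image_mset vimage_def Int_def conj_commute)
    moreover have "gt_of_tableau l T (Suc k) i = gt_of_tableau l T k i + card (?A i)" for i
    proof -
      have "{j. j < row l i \<and> T (i, j) < Suc k} = {j. j < row l i \<and> T (i, j) < k} \<union> ?A i"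
        by auto
      then show ?thesis unfolding gt_of_tableau_def by (simp, subst card_Un_disjoint) auto
    qed
    ultimately show ?thesis by (simp add: level_sum_def sum.distrib)
  qed
  then show ?thesis by (auto simp: multiset_eq_iff)
qed

text \<open>An entry is determined by the numbers exceeding it, and a level by the columns it
  covers, so the two translations are mutually inverse.\<close>

lemma schur_eq_card_gt_patterns:
  assumes "is_partition l"
  shows "schur l m = int (card (gt_patterns l m))"
proof -
  have gt_tab: "gt_of_tableau l (tableau_of_gt l g) = g" if "gt_pattern l g" for g
  proof (intro ext)
    fix k i
    have "j < gt_of_tableau l (tableau_of_gt l g) k i \<longleftrightarrow> j < g k i" for j
      using less_gt_of_tableau_iff[OF ssyt_tableau_of_gt[OF assms that]]
        less_tableau_of_gt_iff[OF that] by blast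
    then show "gt_of_tableau l (tableau_of_gt l g) k i = g k i" by (meson nat_neq_iff)
  qed
  have tab_gt: "tableau_of_gt l (gt_of_tableau l T) = T" if "ssyt l T" for T
  proof
    fix p :: "nat \<times> nat"
    obtain i j where p: "p = (i, j)" by (cases p)
    show "tableau_of_gt l (gt_of_tableau l T) p = T p"
    proof (cases "j < row l i")
      case True
      then have "tableau_of_gt l (gt_of_tableau l T) (i, j) < k \<longleftrightarrow> T (i, j) < k" for k
        using less_gt_of_tableau_iff[OF that, of j k i]
          less_tableau_of_gt_iff[OF gt_pattern_of_tableau[OF assms that], of j i k] by blast
      then show ?thesis unfolding p by (meson nat_neq_iff)
    next
      case False
      then have "T p = 0" using that by (simp add: ssyt_def p)
      with False show ?thesis by (simp add: p tableau_of_gt_def)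
    qed
  qed
  have "bij_betw (gt_of_tableau l)
    {T. ssyt l T \<and> image_mset T (mset_set (young l)) = m} (gt_patterns l m)"
    using weight_iff[of l _ m] weight_iff[OF ssyt_tableau_of_gt[OF assms], of _ m]
    by (intro bij_betw_byWitness[where f' = "tableau_of_gt l"])
      (fastforce simp: gt_tab tab_gt gt_patterns_def gt_pattern_of_tableau[OF assms]
         ssyt_tableau_of_gt[OF assms])+
  then show ?thesis unfolding schur_def by (simp add: bij_betw_same_card)
qed

section \<open>Symmetry of Schur functions\<close>

definition swap_vars :: "nat \<Rightarrow> monom \<Rightarrow> monom" where
  "swap_vars k m = image_mset (transpose k (Suc k)) m"

lemma count_swap_vars: "count (swap_vars k m) j = count m (transpose k (Suc k) j)"
proof -
  have "transpose k (Suc k) x = j \<longleftrightarrow> x = transpose k (Suc k) j" for x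
    by (metis transpose_involutory)
  then show ?thesis unfolding swap_vars_def by (induction m) simp_all
qed

lemma swap_vars_involutory [simp]: "swap_vars k (swap_vars k m) = m"
  by (rule multiset_eqI) (simp add: count_swap_vars)

text \<open>
  The Bender-Knuth involution: interlacing confines \<open>g (Suc k) i\<close> to an interval given by the
  neighbouring levels, and reflecting it there exchanges the multiplicities of \<open>k\<close> and \<open>Suc k\<close>.
\<close>

definition toggle_hi :: "nat \<Rightarrow> (nat \<Rightarrow> nat \<Rightarrow> nat) \<Rightarrow> nat \<Rightarrow> nat" where
  "toggle_hi k g i = (if i = 0 then g (Suc (Suc k)) 0 else min (g (Suc (Suc k)) i) (g k (i - 1)))"

definition toggle_lo :: "nat \<Rightarrow> (nat \<Rightarrow> nat \<Rightarrow> nat) \<Rightarrow> nat \<Rightarrow> nat" where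
  "toggle_lo k g i = max (g k i) (g (Suc (Suc k)) (Suc i))"

definition toggle :: "nat \<Rightarrow> (nat \<Rightarrow> nat \<Rightarrow> nat) \<Rightarrow> nat \<Rightarrow> nat \<Rightarrow> nat" where
  "toggle k g = g(Suc k := \<lambda>i. toggle_hi k g i + toggle_lo k g i - g (Suc k) i)"

lemma toggle_bounds:
  assumes "gt_pattern l g"
  shows "toggle_lo k g i \<le> g (Suc k) i" "g (Suc k) i \<le> toggle_hi k g i"
proof -
  have "g k i \<le> g (Suc k) i" "g (Suc k) i \<le> g (Suc (Suc k)) i"
    "g (Suc k) (Suc i) \<le> g k i" for k i
    using assms unfolding gt_pattern_def by blast+
  then show "toggle_lo k g i \<le> g (Suc k) i" "g (Suc k) i \<le> toggle_hi k g i"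
    by (auto simp: toggle_lo_def toggle_hi_def gr0_conv_Suc)
qed

text \<open>The interlacing inequalities that involve level \<open>Suc k\<close> say exactly that it
  lies between \<open>toggle_lo\<close> and \<open>toggle_hi\<close>, and reflection preserves this
  interval.\<close>

lemma gt_pattern_toggle:
  assumes "gt_pattern l g"
  shows "gt_pattern l (toggle k g)"
proof -
  let ?h = "toggle k g"
  note b = toggle_bounds[OF assms, of k]
  have h: "toggle_lo k g i \<le> ?h (Suc k) i" "?h (Suc k) i \<le> toggle_hi k g i" for i
    using b[of i] by (auto simp: toggle_def)
  have other: "?h k' i = g k' i" if "k' \<noteq> Suc k" for k' i
    using that by (simp add: toggle_def)
  have lo: "g k i \<le> ?h (Suc k) i" "g (Suc (Suc k)) (Suc i) \<le> ?h (Suc k) i" for i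
    using h(1)[of i] by (auto simp: toggle_lo_def)
  have hi: "?h (Suc k) i \<le> g (Suc (Suc k)) i" "?h (Suc k) (Suc i) \<le> g k i" for i
    using h(2)[of i] h(2)[of "Suc i"] by (auto simp: toggle_hi_def split: if_splits)
  have "?h 0 i = 0" for i
    using assms by (simp add: other gt_pattern_def)
  moreover have "?h k' i \<le> ?h (Suc k') i" for k' i
    using assms lo hi other unfolding gt_pattern_def
    by (metis n_not_Suc_n nat.inject)
  moreover have "?h (Suc k') (Suc i) \<le> ?h k' i" for k' i
    using assms lo hi other unfolding gt_pattern_def
    by (metis n_not_Suc_n nat.inject)
  moreover have "?h k' i \<le> row l i" for k' i
  proof -
    have "g k' i \<le> row l i" for k' i using assms by (auto simp: gt_pattern_def)
    then show ?thesis using hi(1)[of i] other[of k' i] by (metis le_trans)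
  qed
  moreover obtain K where K: "\<And>k i. k \<ge> K \<Longrightarrow> g k i = row l i"
    using gt_pattern_eventually[OF assms] by blast
  have "?h (Suc (Suc (K + k))) i = row l i" for i
    using K by (simp add: other)
  ultimately show ?thesis unfolding gt_pattern_def by blast
qed

text \<open>The interval depends only on levels \<open>k\<close> and \<open>Suc (Suc k)\<close>, so
  the second reflection takes place in the same interval.\<close>

lemma toggle_involutory:
  assumes "gt_pattern l g"
  shows "toggle k (toggle k g) = g"
proof -
  have "toggle_hi k (toggle k g) = toggle_hi k g" "toggle_lo k (toggle k g) = toggle_lo k g"
    by (auto simp: toggle_hi_def toggle_lo_def toggle_def)
  then show ?thesis
    using toggle_bounds[OF assms, of k] by (auto simp: toggle_def fun_eq_iff trans_le_add1)
qed

text \<open>A minimum and a maximum of the same two numbers add up to their sum, so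
  \<open>toggle_hi\<close> in row \<open>Suc i\<close> and \<open>toggle_lo\<close> in row
  \<open>i\<close> together give entries of the neighbouring levels. The boundary term past the last
  row is zero.\<close>

lemma level_sum_toggle:
  assumes "gt_pattern l g"
  shows "level_sum l (toggle k g) (Suc k) + level_sum l g (Suc k) =
    level_sum l g k + level_sum l g (Suc (Suc k))"
proof -
  have step: "toggle_hi k g (Suc i) + toggle_lo k g i = g k i + g (Suc (Suc k)) (Suc i)" for i
    by (simp add: toggle_hi_def toggle_lo_def)
  have *: "(\<Sum>i<L. toggle_hi k g i + toggle_lo k g i) + toggle_hi k g L =
      (\<Sum>i<L. g k i) + (\<Sum>i<L. g (Suc (Suc k)) i) + g (Suc (Suc k)) L" for L
  proof (induction L)
    case (Suc L)
    then show ?case using step[of L] by simp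
  qed (simp add: toggle_hi_def)
  have "g k' (length l) = 0" for k'
  proof -
    have "g k' (length l) \<le> row l (length l)" using assms by (auto simp: gt_pattern_def)
    then show ?thesis by (simp add: row_def)
  qed
  then have "g (Suc (Suc k)) (length l) = 0" "toggle_hi k g (length l) = 0"
    by (auto simp: toggle_hi_def)
  with *[of "length l"] have "(\<Sum>i<length l. toggle_hi k g i + toggle_lo k g i) =
      level_sum l g k + level_sum l g (Suc (Suc k))"
    by (simp add: level_sum_def)
  moreover have "toggle k g (Suc k) i + g (Suc k) i = toggle_hi k g i + toggle_lo k g i" for i
    using toggle_bounds[OF assms, of k i] by (simp add: toggle_def)
  ultimately show ?thesis by (simp add: level_sum_def flip: sum.distrib)
qed

lemma toggle_in_gt_patterns:
  assumes "g \<in> gt_patterns l m"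
  shows "toggle k g \<in> gt_patterns l (swap_vars k m)"
proof -
  have g: "gt_pattern l g" and w: "\<And>k. level_sum l g (Suc k) = level_sum l g k + count m k"
    using assms by (auto simp: gt_patterns_def)
  have other: "level_sum l (toggle k g) k' = level_sum l g k'" if "k' \<noteq> Suc k" for k'
    using that by (simp add: level_sum_def toggle_def)
  have "level_sum l (toggle k g) (Suc k') = level_sum l (toggle k g) k' + count (swap_vars k m) k'" for k'
    using level_sum_toggle[OF g, of k] w[of k'] w[of k] w[of "Suc k"] other[of k'] other[of "Suc k'"]
    by (cases "k' = k"; cases "k' = Suc k") (auto simp: count_swap_vars)
  with gt_pattern_toggle[OF g] show ?thesis by (simp add: gt_patterns_def)
qed

lemma schur_swap_vars:
  assumes "is_partition l"
  shows "schur l (swap_vars k m) = schur l m"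
proof -
  have "bij_betw (toggle k) (gt_patterns l m) (gt_patterns l (swap_vars k m))"
  proof (rule bij_betw_byWitness[where f' = "toggle k"])
    show "toggle k ` gt_patterns l (swap_vars k m) \<subseteq> gt_patterns l m"
      using toggle_in_gt_patterns[of _ l "swap_vars k m" k] by auto
    show "toggle k ` gt_patterns l m \<subseteq> gt_patterns l (swap_vars k m)"
      using toggle_in_gt_patterns by auto
  qed (auto simp: gt_patterns_def toggle_involutory)
  then show ?thesis using assms by (simp add: schur_eq_card_gt_patterns bij_betw_same_card)
qed

section \<open>Existence and uniqueness of Schur expansions\<close>

definition content :: "nat list \<Rightarrow> monom" where
  "content l = (\<Sum>i<length l. replicate_mset (l ! i) i)"

lemma count_content [simp]: "count (content l) i = row l i"
proof -
  have "count (content l) i = (\<Sum>j<length l. if j = i then l ! j else 0)"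
    by (auto simp: content_def count_sum intro: sum.cong)
  then show ?thesis by (simp add: row_def)
qed

text \<open>Column strictness in terms of patterns: row \<open>i\<close> of a tableau has no entry
  less than \<open>i\<close>.\<close>

lemma gt_pattern_zero:
  assumes "gt_pattern l g" "k \<le> i"
  shows "g k i = 0"
  using assms(2)
proof (induction k arbitrary: i)
  case 0
  then show ?case using assms(1) by (auto simp: gt_pattern_def)
next
  case (Suc k)
  then obtain i' where i: "i = Suc i'" "k \<le> i'" by (cases i) auto
  have "g (Suc k) (Suc i') \<le> g k i'" using assms(1) by (auto simp: gt_pattern_def)
  with Suc.IH[OF i(2)] show ?case by (simp add: i(1))
qed

lemma level_sum_eq:
  assumes "gt_pattern l g"
  shows "level_sum l g k = (\<Sum>i<k. g k i)"
proof -
  have z: "g k i = 0" if "length l \<le> i \<or> k \<le> i" for i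
  proof -
    have "g k i \<le> row l i" using assms by (auto simp: gt_pattern_def)
    then show ?thesis using that gt_pattern_zero[OF assms] by (auto simp: row_def split: if_splits)
  qed
  have "level_sum l g k = (\<Sum>i<max k (length l). g k i)"
    unfolding level_sum_def by (rule sum.mono_neutral_left) (auto simp: z)
  also have "\<dots> = (\<Sum>i<k. g k i)"
    by (rule sum.mono_neutral_right) (auto simp: z)
  finally show ?thesis .
qed

lemma level_sum_eq_sum_count:
  assumes "g \<in> gt_patterns l m"
  shows "level_sum l g k = (\<Sum>j<k. count m j)"
proof (induction k)
  case 0
  show ?case using assms by (simp add: gt_patterns_def gt_pattern_def level_sum_def)
next
  case (Suc k)
  then show ?case using assms by (simp add: gt_patterns_def)
qed

text \<open>This is the dominance order: the weight of a tableau is dominated by its shape.\<close>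

lemma sum_count_le_sum_row:
  assumes "g \<in> gt_patterns l m"
  shows "(\<Sum>j<k. count m j) \<le> (\<Sum>i<k. row l i)"
proof -
  have g: "gt_pattern l g" using assms by (simp add: gt_patterns_def)
  then have "(\<Sum>i<k. g k i) \<le> (\<Sum>i<k. row l i)"
    by (intro sum_mono) (auto simp: gt_pattern_def)
  then show ?thesis using level_sum_eq[OF g, of k] level_sum_eq_sum_count[OF assms, of k] by simp
qed

lemma list_less_rowE:
  assumes "l < l'" "is_partition l'"
  obtains k where "\<And>i. i < k \<Longrightarrow> row l i = row l' i" "row l k < row l' k"
proof -
  consider "length l < length l'" "take (length l) l' = l"
    | k where "k < min (length l) (length l')" "take k l = take k l'" "l ! k < l' ! k"
    using assms(1) unfolding list_less_def lexord_take_index_conv by blast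
  then show ?thesis
  proof cases
    case 1
    show ?thesis
    proof (rule that[of "length l"])
      show "row l i = row l' i" if "i < length l" for i
        using 1 that by (metis less_trans nth_take row_def)
      \<comment> \<open>If \<open>l\<close> is a proper prefix, strictness comes from the parts of
        \<open>l'\<close> being nonzero.\<close>
      have "l' ! length l \<noteq> 0"
        using 1(1) assms(2) unfolding is_partition_def by (metis nth_mem)
      then show "row l (length l) < row l' (length l)" using 1(1) by (simp add: row_def)
    qed
  next
    case 2
    show ?thesis
    proof (rule that[of k])
      show "row l i = row l' i" if "i < k" for i
        using 2(1,2) that by (metis less_trans min_less_iff_conj nth_take row_def)
      show "row l k < row l' k" using 2 by (simp add: row_def)
    qed
  qed
qed

text \<open>Lexicographic order refines dominance: at the first difference the partial sum of
  \<open>l'\<close> exceeds that of \<open>l\<close>.\<close>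

lemma schur_content_eq_0:
  assumes "is_partition l" "is_partition l'" "l < l'"
  shows "schur l (content l') = 0"
proof -
  obtain k where k: "\<And>i. i < k \<Longrightarrow> row l i = row l' i" "row l k < row l' k"
    using list_less_rowE assms by metis
  have "gt_patterns l (content l') = {}"
  proof (rule equals0I)
    fix g assume "g \<in> gt_patterns l (content l')"
    from sum_count_le_sum_row[OF this, of "Suc k"] k show False by simp
  qed
  then show ?thesis using assms by (simp add: schur_eq_card_gt_patterns)
qed

text \<open>Equality in all dominance inequalities forces every row before \<open>k\<close> to be
  full at level \<open>k\<close>. The only tableau left has constant entry \<open>i\<close> in row
  \<open>i\<close>.\<close>

lemma gt_patterns_content_self:
  assumes "is_partition l"
  shows "gt_patterns l (content l) = {\<lambda>k i. if i < k then row l i else 0}"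
proof (rule equalityI; rule subsetI)
  fix g assume g: "g \<in> gt_patterns l (content l)"
  then have gt: "gt_pattern l g" by (simp add: gt_patterns_def)
  have "g k i = row l i" if "i < k" for k i
  proof -
    have "(\<Sum>i<k. g k i) = (\<Sum>i<k. row l i)"
      using level_sum_eq[OF gt] level_sum_eq_sum_count[OF g] by simp
    moreover have "g k i \<le> row l i" for i using gt by (auto simp: gt_pattern_def)
    ultimately show ?thesis using that sum_mono_inv[of "g k" "{..<k}" "row l" i] by auto
  qed
  with gt_pattern_zero[OF gt] show "g \<in> {\<lambda>k i. if i < k then row l i else 0}"
    by (auto simp: fun_eq_iff)
next
  fix g assume "g \<in> {\<lambda>k i. if i < k then row l i else 0}"
  then have g: "g = (\<lambda>k i. if i < k then row l i else 0)" by simp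
  have "row l i = 0" if "length l \<le> i" for i using that by (simp add: row_def)
  then have "gt_pattern l g"
    using row_antimono[OF assms]
    by (auto simp: gt_pattern_def g not_less intro!: exI[of _ "length l"])
  moreover have "level_sum l g (Suc k) = level_sum l g k + count (content l) k" for k
    unfolding level_sum_eq[OF calculation] by (simp add: g)
  ultimately show "g \<in> gt_patterns l (content l)" by (simp add: gt_patterns_def)
qed

lemma schur_content_self: "is_partition l \<Longrightarrow> schur l (content l) = 1"
  by (simp add: schur_eq_card_gt_patterns gt_patterns_content_self)

lemma size_eq_sum_count:
  assumes "set_mset m \<subseteq> {..<k::nat}"
  shows "size m = (\<Sum>j<k. count m j)"
  unfolding size_multiset_overloaded_eq
  by (rule sum.mono_neutral_left) (use assms in \<open>auto simp: not_in_iff\<close>)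

lemma schur_homogeneous:
  assumes "is_partition l" "schur l m \<noteq> 0"
  shows "size m = sum_list l"
proof -
  obtain g where g: "g \<in> gt_patterns l m"
    using assms by (fastforce simp: schur_eq_card_gt_patterns)
  then have gt: "gt_pattern l g" by (simp add: gt_patterns_def)
  obtain K where K: "\<And>k i. k \<ge> K \<Longrightarrow> g k i = row l i"
    using gt_pattern_eventually[OF gt] by blast
  have "finite (set_mset m)" by simp
  then obtain K' where K': "set_mset m \<subseteq> {..<K'}" by (meson finite_nat_iff_bounded)
  let ?k = "max K K'"
  have "size m = (\<Sum>j<?k. count m j)" using K' by (intro size_eq_sum_count) auto
  also have "\<dots> = level_sum l g ?k" using level_sum_eq_sum_count[OF g] by simp
  also have "\<dots> = (\<Sum>i<length l. l ! i)" using K by (simp add: level_sum_def row_def)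
  also have "\<dots> = sum_list l" by (simp add: sum_list_sum_nth atLeast0LessThan)
  finally show ?thesis .
qed

lemma size_content [simp]: "size (content l) = sum_list l"
  by (simp add: content_def sum_list_sum_nth atLeast0LessThan)

section \<open>Symmetric series are determined by their coefficients at partitions\<close>

definition swap_invariant :: "series \<Rightarrow> bool" where
  "swap_invariant f \<longleftrightarrow> (\<forall>k m. f (swap_vars k m) = f m)"

text \<open>Moving the excess from index \<open>Suc k\<close> to \<open>k\<close> lowers the sum of
  the indices. This is the termination measure for sorting exponents by adjacent swaps.\<close>

lemma sum_mset_swap_vars_less:
  assumes "count m k < count m (Suc k)"
  shows "sum_mset (swap_vars k m) < sum_mset m"
proof -
  let ?N = "filter_mset (\<lambda>x. x \<noteq> k \<and> x \<noteq> Suc k) m"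
  have m: "m = ?N + replicate_mset (count m k) k + replicate_mset (count m (Suc k)) (Suc k)"
    by (rule multiset_eqI) auto
  have s: "swap_vars k m = ?N + replicate_mset (count m (Suc k)) k + replicate_mset (count m k) (Suc k)"
    by (rule multiset_eqI) (auto simp: count_swap_vars transpose_def)
  show ?thesis
    by (subst (2) m, subst s) (use assms in \<open>simp add: algebra_simps\<close>)
qed

lemma ex_partition_content:
  assumes "\<And>k. count m (Suc k) \<le> count m k"
  shows "\<exists>l. is_partition l \<and> m = content l"
proof -
  have mono: "count m j \<le> count m i" if "i \<le> j" for i j
    using that by (induction rule: dec_induct) (auto intro: le_trans assms)
  have "finite (set_mset m)" by simp
  then obtain K where "set_mset m \<subseteq> {..<K}" by (meson finite_nat_iff_bounded)
  then have "count m K = 0" by (auto simp: not_in_iff)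
  define L where "L = (LEAST k. count m k = 0)"
  have L: "count m L = 0" unfolding L_def using \<open>count m K = 0\<close> by (rule LeastI)
  have "count m i \<noteq> 0" if "i < L" for i using that unfolding L_def by (rule not_less_Least)
  moreover have "count m i = 0" if "L \<le> i" for i using mono[OF that] L by simp
  ultimately have "is_partition (map (count m) [0..<L])" "m = content (map (count m) [0..<L])"
    by (auto simp: is_partition_def sorted_wrt_iff_nth_less mono multiset_eq_iff row_def count_eq_zero_iff)
  then show ?thesis by blast
qed

text \<open>Adjacent swaps sort the exponents of any monomial into a partition without changing its
  coefficient.\<close>

lemma swap_invariant_eq_0:
  assumes "swap_invariant f" "\<And>l. is_partition l \<Longrightarrow> f (content l) = 0"
  shows "f m = 0"
proof (induction m rule: measure_induct_rule[where f = sum_mset])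
  case (less m)
  show ?case
  proof (cases "\<forall>k. count m (Suc k) \<le> count m k")
    case True
    then show ?thesis using ex_partition_content assms(2) by blast
  next
    case False
    then obtain k where "count m k < count m (Suc k)" by (auto simp: not_le)
    from less.IH[OF sum_mset_swap_vars_less[OF this]] show ?thesis
      using assms(1) by (simp add: swap_invariant_def)
  qed
qed

section \<open>Expansions into Schur functions\<close>

lemma schur_expansion_eq_sum:
  assumes "schur_expansion f c" "finite A" "{l. c l \<noteq> 0} \<subseteq> A"
  shows "f m = (\<Sum>l\<in>A. c l * schur l m)"
proof -
  have "f m = (\<Sum>l | c l \<noteq> 0. c l * schur l m)" using assms(1) by (simp add: schur_expansion_def)
  also have "\<dots> = (\<Sum>l\<in>A. c l * schur l m)"
    using assms(2,3) by (intro sum.mono_neutral_left) auto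
  finally show ?thesis .
qed

lemma schur_expansionI:
  assumes "finite A" "{l. c l \<noteq> 0} \<subseteq> A" "\<And>l. c l \<noteq> 0 \<Longrightarrow> is_partition l"
    "\<And>m. f m = (\<Sum>l\<in>A. c l * schur l m)"
  shows "schur_expansion f c"
proof -
  have "f m = (\<Sum>l | c l \<noteq> 0. c l * schur l m)" for m
    unfolding assms(4) using assms(1,2) by (intro sum.mono_neutral_right) auto
  then show ?thesis
    using assms(1-3) finite_subset unfolding schur_expansion_def by blast
qed

text \<open>Unitriangularity: at the content of the largest partition where \<open>c\<close> and
  \<open>c'\<close> differ, only the term of that partition survives in the difference.\<close>

lemma schur_expansion_unique:
  assumes c: "schur_expansion f c" and c': "schur_expansion f c'"
  shows "c = c'"
proof (rule ccontr)
  assume "c \<noteq> c'"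
  define A where "A = {l. c l \<noteq> 0} \<union> {l. c' l \<noteq> 0}"
  define D where "D = {l \<in> A. c l \<noteq> c' l}"
  have A: "finite A" "\<And>l. l \<in> A \<Longrightarrow> is_partition l"
    using c c' by (auto simp: A_def schur_expansion_def)
  obtain l where "c l \<noteq> c' l" using \<open>c \<noteq> c'\<close> by (auto simp: fun_eq_iff)
  then have "D \<noteq> {}" by (cases "c l = 0") (auto simp: D_def A_def)
  moreover have "finite D" using A(1) by (simp add: D_def)
  ultimately have M: "Max D \<in> D" "\<And>l. l \<in> D \<Longrightarrow> l \<le> Max D" by auto
  let ?M = "Max D"
  have P: "is_partition ?M" using M(1) A(2) by (auto simp: D_def)
  have "0 = (\<Sum>l\<in>A. c l * schur l (content ?M)) - (\<Sum>l\<in>A. c' l * schur l (content ?M))"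
    using schur_expansion_eq_sum[OF c A(1), of "content ?M"]
      schur_expansion_eq_sum[OF c' A(1), of "content ?M"] by (auto simp: A_def)
  also have "\<dots> = (\<Sum>l\<in>A. (c l - c' l) * schur l (content ?M))"
    by (simp add: left_diff_distrib sum_subtractf)
  also have "\<dots> = (\<Sum>l\<in>{?M}. (c l - c' l) * schur l (content ?M))"
  proof (rule sum.mono_neutral_right)
    show "\<forall>l\<in>A - {?M}. (c l - c' l) * schur l (content ?M) = 0"
      using M(2) A(2) P schur_content_eq_0 by (auto simp: D_def less_le)
  qed (use A(1) M(1) in \<open>auto simp: D_def\<close>)
  also have "\<dots> = c ?M - c' ?M" using P by (simp add: schur_content_self)
  finally show False using M(1) by (simp add: D_def)
qed

lemma finite_partitions_sum_list: "finite {l. is_partition l \<and> sum_list l = N}"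
proof (rule finite_subset)
  have "length l \<le> sum_list l" if "0 \<notin> set l" for l :: "nat list"
    using that by (induction l) auto
  then show "{l. is_partition l \<and> sum_list l = N} \<subseteq> {l. set l \<subseteq> {..N} \<and> length l \<le> N}"
    by (auto simp: is_partition_def intro: member_le_sum_list)
qed (simp add: finite_lists_length_le)

lemma ex_schur_expansion:
  assumes "swap_invariant f" "\<And>m. size m \<noteq> N \<Longrightarrow> f m = 0"
  shows "\<exists>c. schur_expansion f c"
proof -
  let ?P = "{l. is_partition l \<and> sum_list l = N}"
  \<comment> \<open>\<open>S\<close> is a lower set among the partitions of \<open>N\<close>, and
    \<open>f\<close> vanishes at the contents of those outside \<open>S\<close>. Subtracting a
    multiple of \<open>schur b\<close> removes the largest element \<open>b\<close> from
    \<open>S\<close>.\<close>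
  have "(\<forall>s\<in>S. \<forall>l\<in>?P. l < s \<longrightarrow> l \<in> S) \<Longrightarrow> S \<subseteq> ?P \<Longrightarrow> swap_invariant f \<Longrightarrow>
      (\<And>m. size m \<noteq> N \<Longrightarrow> f m = 0) \<Longrightarrow> (\<And>l. l \<in> ?P - S \<Longrightarrow> f (content l) = 0) \<Longrightarrow>
      \<exists>c. schur_expansion f c" if "finite S" for S f
    using that
  proof (induction S arbitrary: f rule: finite_linorder_max_induct)
    case empty
    have "f (content l) = 0" if "is_partition l" for l
      using empty that by (cases "sum_list l = N") auto
    then have "f = (\<lambda>m. 0)" using swap_invariant_eq_0 empty(3) by blast
    then have "schur_expansion f (\<lambda>l. 0)" by (simp add: schur_expansion_def)
    then show ?case by blast
  next
    case (insert b S f)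
    have b: "is_partition b" "sum_list b = N" using insert.prems(2) by auto
    define f' where "f' m = f m - f (content b) * schur b m" for m
    have "\<exists>c. schur_expansion f' c"
    proof (rule insert.IH)
      show "\<forall>s\<in>S. \<forall>l\<in>?P. l < s \<longrightarrow> l \<in> S"
        using insert.prems(1) insert.hyps(2) by (metis insertE insertI2 less_asym)
      show "S \<subseteq> ?P" using insert.prems(2) by blast
      show "swap_invariant f'"
        using insert.prems(3) schur_swap_vars[OF b(1)] by (simp add: swap_invariant_def f'_def)
      show "f' m = 0" if "size m \<noteq> N" for m
        using that insert.prems(4) schur_homogeneous[OF b(1)] b(2) by (auto simp: f'_def)
      show "f' (content l) = 0" if l: "l \<in> ?P - S" for l
      proof (cases "l = b")
        case True
        then show ?thesis using b by (simp add: f'_def schur_content_self)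
      next
        case False
        \<comment> \<open>A smaller \<open>l\<close> would lie in the lower set; for a larger one
          \<open>schur b\<close> vanishes at \<open>content l\<close>.\<close>
        have "\<not> l < b" using insert.prems(1) l False by blast
        with False have "b < l" by simp
        then show ?thesis
          using l False insert.prems(5)[of l] b schur_content_eq_0 by (auto simp: f'_def)
      qed
    qed
    then obtain c where c: "schur_expansion f' c" by blast
    define A where "A = insert b {l. c l \<noteq> 0}"
    have A: "finite A" using c by (simp add: A_def schur_expansion_def)
    have "schur_expansion f (c(b := c b + f (content b)))"
    proof (rule schur_expansionI[OF A])
      show "{l. (c(b := c b + f (content b))) l \<noteq> 0} \<subseteq> A" by (auto simp: A_def)
      show "is_partition l" if "(c(b := c b + f (content b))) l \<noteq> 0" for l
        using that c b(1) by (auto simp: schur_expansion_def split: if_splits)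
      fix m
      have "f m = (\<Sum>l\<in>A. c l * schur l m) + f (content b) * schur b m"
        using schur_expansion_eq_sum[OF c A, of m] by (simp add: f'_def A_def subset_insertI)
      also have "(\<Sum>l\<in>A. c l * schur l m) = c b * schur b m + (\<Sum>l\<in>A-{b}. c l * schur l m)"
        using A by (intro sum.remove) (auto simp: A_def)
      also have "(\<Sum>l\<in>A-{b}. c l * schur l m) =
          (\<Sum>l\<in>A-{b}. (c(b := c b + f (content b))) l * schur l m)"
        by (rule sum.cong) auto
      also have "c b * schur b m + \<dots> + f (content b) * schur b m =
          (c(b := c b + f (content b))) b * schur b m + \<dots>"
        by (simp add: algebra_simps)
      also have "\<dots> = (\<Sum>l\<in>A. (c(b := c b + f (content b))) l * schur l m)"
        using A by (intro sum.remove[symmetric]) (auto simp: A_def)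
      finally show "f m = (\<Sum>l\<in>A. (c(b := c b + f (content b))) l * schur l m)" .
    qed
    then show ?case by blast
  qed
  from this[of ?P f] finite_partitions_sum_list assms show ?thesis by blast
qed

lemma schur_expansion_schur_coeff:
  assumes "swap_invariant f" "\<And>m. size m \<noteq> N \<Longrightarrow> f m = 0"
  shows "schur_expansion f (schur_coeff f)"
proof -
  have "\<exists>!c. schur_expansion f c"
    using ex_schur_expansion[OF assms] schur_expansion_unique by blast
  then show ?thesis unfolding schur_coeff_def by (rule theI')
qed

section \<open>Coefficients at partitions with three rows\<close>

text \<open>Without variables of index at least \<open>k\<close> the level sum stays constant from
  \<open>k\<close> on, and a level inside the shape with the same sum is the shape.\<close>

lemma gt_patterns_const:
  assumes g: "g \<in> gt_patterns l m" and m: "\<And>j. k \<le> j \<Longrightarrow> count m j = 0"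
  shows "g k i = row l i"
proof -
  have gt: "gt_pattern l g" using g by (simp add: gt_patterns_def)
  obtain K where K: "\<And>k i. k \<ge> K \<Longrightarrow> g k i = row l i"
    using gt_pattern_eventually[OF gt] by blast
  have le: "g k i \<le> row l i" for i using gt by (auto simp: gt_pattern_def)
  have "(\<Sum>j<max k K. count m j) = (\<Sum>j<k. count m j)"
    using m by (intro sum.mono_neutral_right) auto
  then have "level_sum l g (max k K) = level_sum l g k"
    using level_sum_eq_sum_count[OF g] by simp
  then have "(\<Sum>i<length l. g k i) = (\<Sum>i<length l. row l i)"
    using K[of "max k K"] by (simp add: level_sum_def)
  then have "g k i = row l i" if "i < length l"
    using sum_mono_inv[of "g k" "{..<length l}" "row l" i] le that by auto
  then show ?thesis using le[of i] by (cases "i < length l") (auto simp: row_def)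
qed

text \<open>
  A pattern with three levels and weight \<open>(x, y, z)\<close> is determined by \<open>b = g 2 0\<close>.
\<close>

definition gt_middle :: "nat list \<Rightarrow> nat \<Rightarrow> nat \<Rightarrow> nat \<Rightarrow> nat set" where
  "gt_middle l x y z = {b. row l 3 = 0 \<and> x + y + z = row l 0 + row l 1 + row l 2 \<and>
     x \<le> b \<and> y \<le> b \<and> row l 1 \<le> b \<and> b \<le> row l 0 \<and> row l 2 + b \<le> x + y \<and> x + y \<le> row l 1 + b}"

definition gt_of_middle :: "nat list \<Rightarrow> nat \<Rightarrow> nat \<Rightarrow> nat \<Rightarrow> nat \<Rightarrow> nat \<Rightarrow> nat" where
  "gt_of_middle l x y b = (\<lambda>k i. if k = 0 then 0 else if k = 1 then (if i = 0 then x else 0)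
     else if k = 2 then (if i = 0 then b else if i = 1 then x + y - b else 0) else row l i)"

lemma row_three: "row [x, y, z] i = (if i = 0 then x else if i = 1 then y else if i = 2 then z else 0)"
  by (auto simp: row_def nth_Cons' numeral_2_eq_2)

lemma nat_three_cases:
  fixes k :: nat
  obtains "k = 0" | "k = 1" | "k = 2" | j where "k = Suc (Suc (Suc j))"
  by (metis One_nat_def not0_implies_Suc numeral_2_eq_2)

text \<open>Shape and weight force every level except 2, where the weight fixes the sum of the two
  entries and leaves one parameter.\<close>

lemma gt_patterns_middle:
  assumes "g \<in> gt_patterns l (content [x, y, z])"
  shows "g 2 0 \<in> gt_middle l x y z" "gt_of_middle l x y (g 2 0) = g"
proof -
  have gt: "gt_pattern l g" using assms by (simp add: gt_patterns_def)
  have 3: "g k i = row l i" if "3 \<le> k" for k i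
    using that by (intro gt_patterns_const[OF assms]) (simp add: row_three)
  have lev: "(\<Sum>i<k. g k i) = (\<Sum>j<k. row [x, y, z] j)" for k
    using level_sum_eq[OF gt] level_sum_eq_sum_count[OF assms] by simp
  have s: "g 1 0 = x" "g 2 0 + g 2 1 = x + y"
    "row l 0 + row l 1 + row l 2 = x + y + z"
    using lev[of 1] lev[of 2] lev[of 3] by (simp_all add: row_three 3 eval_nat_numeral)
  have z: "g k i = 0" if "k \<le> i" for k i using gt_pattern_zero[OF gt that] .
  have mono: "g k i \<le> g (Suc k) i" "g (Suc k) (Suc i) \<le> g k i" for k i
    using gt by (auto simp: gt_pattern_def)
  have "row l 3 = 0" using z[of 3 3] 3[of 3 3] by simp
  moreover have "g 1 0 \<le> g 2 0" "g 2 1 \<le> g 1 0" "g 2 0 \<le> row l 0" "g 2 1 \<le> row l 1"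
    "row l 1 \<le> g 2 0" "row l 2 \<le> g 2 1"
    using mono(1)[of 1 0] mono(2)[of 1 0] mono(1)[of 2 0] mono(1)[of 2 1] mono(2)[of 2 0]
      mono(2)[of 2 1] 3[of 3] by (simp_all add: eval_nat_numeral)
  ultimately show "g 2 0 \<in> gt_middle l x y z"
    using s unfolding gt_middle_def by auto
  show "gt_of_middle l x y (g 2 0) = g"
  proof (intro ext)
    fix k i
    have "g 2 1 = x + y - g 2 0" using s by simp
    then show "gt_of_middle l x y (g 2 0) k i = g k i"
      using s(1) z[of 0 i] z[of 1 i] z[of 2 i] 3[of k i]
      by (cases "i = 0"; cases "i = 1"; cases k rule: nat_three_cases)
        (auto simp: gt_of_middle_def)
  qed
qed

lemma gt_of_middle_in_gt_patterns:
  assumes l: "is_partition l" and b: "b \<in> gt_middle l x y z"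
  shows "gt_of_middle l x y b \<in> gt_patterns l (content [x, y, z])"
proof -
  let ?g = "gt_of_middle l x y b"
  have r: "row l (Suc i) \<le> row l i" for i using row_antimono[OF l] by simp
  have r0: "row l i = 0" if "3 \<le> i" for i
    using row_antimono[OF l that] b by (simp add: gt_middle_def)
  have B: "x + y + z = row l 0 + row l 1 + row l 2" "x \<le> b" "y \<le> b" "row l 1 \<le> b"
    "b \<le> row l 0" "row l 2 + b \<le> x + y" "x + y \<le> row l 1 + b"
    using b by (auto simp: gt_middle_def)
  have "?g k i \<le> ?g (Suc k) i" for k i
    using B by (cases k rule: nat_three_cases; cases "i = 0"; cases "i = 1")
      (auto simp: gt_of_middle_def)
  moreover have "?g (Suc k) (Suc i) \<le> ?g k i" for k i
    using B r0[of "Suc i"] r[of i]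
    by (cases k rule: nat_three_cases; cases i rule: nat_three_cases)
      (auto simp: gt_of_middle_def eval_nat_numeral)
  moreover have "?g k i \<le> row l i" for k i
    using B by (auto simp: gt_of_middle_def)
  moreover have "?g 3 i = row l i" for i by (simp add: gt_of_middle_def)
  moreover have "?g 0 i = 0" for i by (simp add: gt_of_middle_def)
  ultimately have gt: "gt_pattern l ?g" unfolding gt_pattern_def by blast
  have lev: "level_sum l ?g (3 + k) = x + y + z" for k
  proof -
    have "level_sum l ?g (3 + k) = (\<Sum>i<3+k. row l i)"
      unfolding level_sum_eq[OF gt] by (simp add: gt_of_middle_def)
    also have "\<dots> = (\<Sum>i<3. row l i)"
      using r0 by (intro sum.mono_neutral_right) auto
    finally show ?thesis using B(1) by (simp add: eval_nat_numeral)
  qed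
  have "level_sum l ?g (Suc k) = level_sum l ?g k + count (content [x, y, z]) k" for k
    using lev[of 0] lev lev[of "Suc _"] B level_sum_eq[OF gt, of 0] level_sum_eq[OF gt, of 1] level_sum_eq[OF gt, of 2]
    by (cases k rule: nat_three_cases)
      (auto simp: row_three gt_of_middle_def eval_nat_numeral)
  with gt show ?thesis by (simp add: gt_patterns_def)
qed

lemma schur_content_three:
  assumes "is_partition l"
  shows "schur l (content [x, y, z]) = int (card (gt_middle l x y z))"
proof -
  have mid: "gt_of_middle l x y b 2 0 = b" for b by (simp add: gt_of_middle_def)
  have "bij_betw (\<lambda>g. g 2 0) (gt_patterns l (content [x, y, z])) (gt_middle l x y z)"
    by (rule bij_betw_byWitness[where f' = "gt_of_middle l x y"])
      (use gt_patterns_middle gt_of_middle_in_gt_patterns[OF assms] in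
        \<open>auto simp: mid\<close>)
  then show ?thesis using assms by (simp add: schur_eq_card_gt_patterns bij_betw_same_card)
qed

text \<open>
  \<open>(x, y)\<close> is a highest weight of \<open>GL\<^sub>2\<close> in the branching of \<open>l\<close>.
\<close>

definition interlaces :: "nat list \<Rightarrow> nat \<Rightarrow> nat \<Rightarrow> nat \<Rightarrow> int" where
  "interlaces l x y z = of_bool (row l 3 = 0 \<and> x + y + z = row l 0 + row l 1 + row l 2 \<and>
     row l 1 \<le> x \<and> x \<le> row l 0 \<and> row l 2 \<le> y \<and> y \<le> row l 1)"

text \<open>The two sets of admissible \<open>b\<close> differ at most in \<open>b = x\<close>. For
  \<open>Suc y \<le> x\<close> this expresses the multiplicity of a highest weight as a difference
  of weight multiplicities; for \<open>y = x\<close> the two weights are conjugate and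
  \<open>interlaces\<close> is zero.\<close>

lemma schur_content_three_step:
  assumes "is_partition l" "y \<le> x"
  shows "schur l (content [x, Suc y, z]) =
    schur l (content [Suc x, y, z]) + interlaces l x (Suc y) z"
proof -
  let ?B = "{b. b = x \<and> interlaces l x (Suc y) z = 1}"
  have "gt_middle l x (Suc y) z = gt_middle l (Suc x) y z \<union> ?B"
    using assms(2) by (auto simp: gt_middle_def interlaces_def)
  moreover have "gt_middle l (Suc x) y z \<inter> ?B = {}" by (auto simp: gt_middle_def)
  moreover have "finite (gt_middle l (Suc x) y z)"
    by (rule finite_subset[of _ "{..row l 0}"]) (auto simp: gt_middle_def)
  moreover have "finite ?B" by simp
  ultimately have "card (gt_middle l x (Suc y) z) = card (gt_middle l (Suc x) y z) + card ?B"
    by (simp add: card_Un_disjoint)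
  moreover have "int (card ?B) = interlaces l x (Suc y) z" by (simp add: interlaces_def)
  ultimately show ?thesis using assms(1) by (simp add: schur_content_three)
qed

lemma partition_eq_three_iff:
  assumes "is_partition l" "z \<noteq> 0"
  shows "l = [x, y, z] \<longleftrightarrow> row l 0 = x \<and> row l 1 = y \<and> row l 2 = z \<and> row l 3 = 0"
proof
  assume *: "row l 0 = x \<and> row l 1 = y \<and> row l 2 = z \<and> row l 3 = 0"
  then have "length l > 2" using assms(2) by (auto simp: row_def split: if_splits)
  moreover have "length l \<le> 3"
  proof (rule ccontr)
    assume "\<not> length l \<le> 3"
    then have "3 < length l" by simp
    then have "l ! 3 \<in> set l" by (rule nth_mem)
    moreover have "l ! 3 = 0" using * \<open>3 < length l\<close> by (simp add: row_def)
    ultimately show False using assms(1) by (simp add: is_partition_def)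
  qed
  ultimately have "length l = 3" by simp
  then obtain a b c where "l = [a, b, c]"
    by (auto simp: eval_nat_numeral length_Suc_conv)
  with * show "l = [x, y, z]" by (simp add: row_three)
qed (simp add: row_three)

text \<open>The terms belong, in this order, to the identity, the two simple transpositions, the two
  3-cycles and the longest permutation. Truncated subtraction is exact once \<open>q \<ge> 1\<close>
  and \<open>r \<ge> 2\<close>.\<close>

definition alternating_sum :: "series \<Rightarrow> nat \<Rightarrow> nat \<Rightarrow> nat \<Rightarrow> int" where
  "alternating_sum f p q r =
     f (content [p, q, r]) - f (content [p + 1, q - 1, r])
     - f (content [p, q + 1, r - 1]) + f (content [p + 1, q + 1, r - 2])
     + f (content [p + 2, q - 1, r - 1]) - f (content [p + 2, q, r - 2])"

lemma alternating_sum_schur: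
  assumes l: "is_partition l" and pqr: "q \<le> p" "r \<le> q" "2 \<le> r"
  shows "alternating_sum (schur l) p q r = of_bool (l = [p, q, r])"
proof -
  obtain q' where q: "q = Suc q'" using pqr by (cases q) auto
  obtain r' where r: "r = Suc (Suc r')" using pqr(3) by (metis add_2_eq_Suc le_Suc_ex)
  note step = schur_content_three_step[OF l]
  \<comment> \<open>Four differences of neighbouring weights are used; the coefficient at
    \<open>[p + 1, q, r - 1]\<close> enters two of them and cancels.\<close>
  have "alternating_sum (schur l) p q r = interlaces l p q r - interlaces l p (Suc q) (r - 1)
      - interlaces l (Suc p) q (r - 1) + interlaces l (Suc p) (Suc q) (r - 2)"
    using step[of q' p r] step[of q p "r - 1"] step[of q' "Suc p" "r - 1"]
      step[of q "Suc p" "r - 2"] pqr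
    by (simp add: alternating_sum_def q)
  also have "\<dots> = of_bool (row l 0 = p \<and> row l 1 = q \<and> row l 2 = r \<and> row l 3 = 0)"
  proof (cases "row l 3 = 0 \<and> p + q + r = row l 0 + row l 1 + row l 2")
    case True
    let ?a = "\<lambda>x. of_bool (row l 1 \<le> x \<and> x \<le> row l 0) :: int"
    let ?b = "\<lambda>y. of_bool (row l 2 \<le> y \<and> y \<le> row l 1) :: int"
    \<comment> \<open>With the total fixed, the condition splits into one on \<open>x\<close> and
      one on \<open>y\<close>, so the four terms become a product of two differences.\<close>
    have *: "interlaces l x y z = ?a x * ?b y" if "x + y + z = p + q + r" for x y z
      using True that by (simp add: interlaces_def flip: of_bool_conj)
    have "interlaces l p q r - interlaces l p (Suc q) (r - 1)
        - interlaces l (Suc p) q (r - 1) + interlaces l (Suc p) (Suc q) (r - 2) =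
        (?a p - ?a (Suc p)) * (?b q - ?b (Suc q))"
      using pqr by (simp add: * algebra_simps)
    also have "?a p - ?a (Suc p) = of_bool (row l 0 = p) - of_bool (row l 1 = Suc p)"
      using row_antimono[OF l, of 0 1] by (auto simp: of_bool_def)
    also have "?b q - ?b (Suc q) = of_bool (row l 1 = q) - of_bool (row l 2 = Suc q)"
      using row_antimono[OF l, of 1 2] by (auto simp: of_bool_def)
    \<comment> \<open>The other three products are excluded by \<open>r \<le> q \<le> p\<close>, the
      order of the rows and the total size.\<close>
    also have "(of_bool (row l 0 = p) - of_bool (row l 1 = Suc p)) *
        (of_bool (row l 1 = q) - of_bool (row l 2 = Suc q)) =
        (of_bool (row l 0 = p \<and> row l 1 = q \<and> row l 2 = r \<and> row l 3 = 0) :: int)"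
      using row_antimono[OF l, of 0 1] row_antimono[OF l, of 1 2] pqr True
      by (cases "row l 0 = p"; cases "row l 1 = q") (auto simp: of_bool_def)
    finally show ?thesis .
  next
    case False
    with pqr have "interlaces l p q r = 0" "interlaces l p (Suc q) (r - 1) = 0"
      "interlaces l (Suc p) q (r - 1) = 0" "interlaces l (Suc p) (Suc q) (r - 2) = 0"
      by (auto simp: interlaces_def)
    with False show ?thesis by auto
  qed
  also have "\<dots> = of_bool (l = [p, q, r])"
    using partition_eq_three_iff[OF l] pqr by simp
  finally show ?thesis .
qed

lemma schur_coeff_three:
  assumes "schur_expansion f c" "q \<le> p" "r \<le> q" "2 \<le> r"
  shows "c [p, q, r] = alternating_sum f p q r"
proof -
  \<comment> \<open>The insertion makes \<open>[p, q, r]\<close> an index of the sum even if its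
    coefficient is zero.\<close>
  let ?A = "insert [p, q, r] {l. c l \<noteq> 0}"
  have A: "finite ?A" using assms(1) by (simp add: schur_expansion_def)
  have P: "is_partition [p, q, r]" using assms(2-4) by (auto simp: is_partition_def)
  have "alternating_sum f p q r = (\<Sum>l\<in>?A. c l * alternating_sum (schur l) p q r)"
    unfolding alternating_sum_def schur_expansion_eq_sum[OF assms(1) A subset_insertI]
    by (simp only: sum_subtractf sum.distrib distrib_left right_diff_distrib)
  also have "\<dots> = (\<Sum>l\<in>?A. c l * of_bool (l = [p, q, r]))"
    using assms P by (intro sum.cong) (auto simp: alternating_sum_schur schur_expansion_def)
  also have "\<dots> = c [p, q, r]" using A by (simp add: of_bool_def if_distrib cong: if_cong)
  finally show ?thesis ..
qed

section \<open>Plethysm coefficients as numbers of factorizations\<close>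

lemma image_mset_Sum_mset: "image_mset f (\<Sum>\<^sub># C) = \<Sum>\<^sub># (image_mset (image_mset f) C)"
  by (induction C) auto

lemma size_Sum_mset_const:
  fixes C :: "'a multiset multiset"
  assumes "\<And>x. x \<in># C \<Longrightarrow> size x = n"
  shows "size (\<Sum>\<^sub># C) = size C * n"
  using assms by (induction C) auto

lemma size_le_size_Sum_mset:
  fixes D :: "'a multiset multiset"
  assumes "\<And>x. x \<in># D \<Longrightarrow> x \<noteq> {#}"
  shows "size D \<le> size (\<Sum>\<^sub># D)"
  using assms
proof (induction D)
  case (add x D)
  then have "1 \<le> size x" by (simp add: Suc_le_eq nonempty_has_size)
  with add show ?case by simp
qed simp

text \<open>There are at most \<open>size w\<close> nonempty parts, each of them a divisor of
  \<open>w\<close>.\<close>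

lemma finite_mset_Sum_mset_eq:
  "finite {D :: 'a multiset multiset. (\<forall>x\<in>#D. x \<noteq> {#}) \<and> \<Sum>\<^sub># D = w}"
proof -
  have fin: "finite {x :: 'b multiset. set_mset x \<subseteq> A \<and> size x \<le> N}" if "finite A" for A N
  proof -
    have "{x. set_mset x \<subseteq> A \<and> size x \<le> N} = (\<Union>k\<le>N. multisets_of_size A k)"
      by (auto simp: multisets_of_size_def)
    then show ?thesis using that by auto
  qed
  let ?X = "{x. set_mset x \<subseteq> set_mset w \<and> size x \<le> size w}"
  have sub: "x \<subseteq># \<Sum>\<^sub># D" if "x \<in># D" for x and D :: "'a multiset multiset"
    using that by (metis mset_subset_eq_add_left multi_member_split sum_mset.add_mset)
  have "{D. (\<forall>x\<in>#D. x \<noteq> {#}) \<and> \<Sum>\<^sub># D = w} \<subseteq> {D. set_mset D \<subseteq> ?X \<and> size D \<le> size w}"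
  proof
    fix D assume "D \<in> {D. (\<forall>x\<in>#D. x \<noteq> {#}) \<and> \<Sum>\<^sub># D = w}"
    then have D: "\<And>x. x \<in># D \<Longrightarrow> x \<noteq> {#}" "\<Sum>\<^sub># D = w" by auto
    have "x \<in> ?X" if "x \<in># D" for x
      using sub[OF that] unfolding D(2) by (simp add: size_mset_mono set_mset_mono)
    moreover have "size D \<le> size w" using size_le_size_Sum_mset[of D] D by blast
    ultimately show "D \<in> {D. set_mset D \<subseteq> ?X \<and> size D \<le> size w}" by blast
  qed
  moreover have "finite \<dots>"
    by (rule fin) (rule fin, simp)
  ultimately show ?thesis by (rule finite_subset)
qed

definition factorizations :: "nat \<Rightarrow> nat \<Rightarrow> monom \<Rightarrow> monom multiset set" where
  "factorizations d n m = {C. size C = d \<and> (\<forall>x\<in>#C. size x = n) \<and> \<Sum>\<^sub># C = m}"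

text \<open>Every monomial of \<open>hsym n\<close> has a single copy, with index 0, so multisets of
  copies are multisets of monomials. The value of \<open>hsym d\<close> depends only on their size,
  hence not on the enumeration.\<close>

lemma plethysm_hsym:
  assumes "1 \<le> n"
  shows "plethysm (hsym d) (hsym n) m = int (card (factorizations d n m))"
proof -
  have copies: "monomial_copies (hsym n) = {x. size x = n} \<times> {0}"
    by (auto simp: monomial_copies_def hsym_def split: if_splits)
  let ?X = "{B. set_mset B \<subseteq> monomial_copies (hsym n) \<and> (\<Sum>y\<in>#B. fst y) = m}"
  have id1: "image_mset (\<lambda>x. (x, 0)) (image_mset fst B) = B"
    if "set_mset B \<subseteq> monomial_copies (hsym n)" for B
  proof -
    have "image_mset (\<lambda>y. (fst y, 0)) B = image_mset id B"
      using that by (intro image_mset_cong) (auto simp: copies)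
    then show ?thesis by (simp add: multiset.map_comp o_def)
  qed
  have "inj_on (image_mset fst) ?X"
    using id1 by (metis (no_types, lifting) inj_onI mem_Collect_eq)
  \<comment> \<open>Positive degree excludes the empty monomial, which makes the index set of the
    sum finite.\<close>
  moreover have "image_mset fst ` ?X \<subseteq> {D. (\<forall>x\<in>#D. x \<noteq> {#}) \<and> \<Sum>\<^sub># D = m}"
    using assms by (fastforce simp: copies)
  ultimately have fin: "finite ?X"
    using finite_mset_Sum_mset_eq inj_on_finite by blast
  have "bij_betw (image_mset fst) {B \<in> ?X. size B = d} (factorizations d n m)"
  proof (rule bij_betw_byWitness[where f' = "image_mset (\<lambda>x. (x, 0))"])
    show "\<forall>B\<in>{B \<in> ?X. size B = d}. image_mset (\<lambda>x. (x, 0)) (image_mset fst B) = B"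
      using id1 by blast
  qed (fastforce simp: factorizations_def copies multiset.map_comp o_def)+
  then have "card {B \<in> ?X. size B = d} = card (factorizations d n m)"
    by (rule bij_betw_same_card)
  moreover have "plethysm (hsym d) (hsym n) m = int (card {B \<in> ?X. size B = d})"
    using fin by (simp add: plethysm_def hsym_def[of d] sum.If_cases Int_def)
  ultimately show ?thesis by simp
qed

lemma swap_invariant_plethysm_hsym:
  assumes "1 \<le> n"
  shows "swap_invariant (plethysm (hsym d) (hsym n))"
proof -
  have *: "image_mset (swap_vars k) C \<in> factorizations d n (swap_vars k m)"
    if "C \<in> factorizations d n m" for k m C
    using that image_mset_Sum_mset[of "transpose k (Suc k)" C]
    by (auto simp: factorizations_def swap_vars_def[abs_def])
  have "bij_betw (image_mset (swap_vars k)) (factorizations d n m) (factorizations d n (swap_vars k m))"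
    for k m
  proof (rule bij_betw_byWitness[where f' = "image_mset (swap_vars k)"])
    show "image_mset (swap_vars k) ` factorizations d n (swap_vars k m) \<subseteq> factorizations d n m"
      using *[of _ "swap_vars k m" k] by auto
  qed (use * in \<open>auto simp: multiset.map_comp o_def\<close>)
  then have "card (factorizations d n m) = card (factorizations d n (swap_vars k m))" for k m
    by (rule bij_betw_same_card)
  then show ?thesis using assms by (simp add: swap_invariant_def plethysm_hsym)
qed

lemma plethysm_hsym_homogeneous:
  assumes "1 \<le> n" "size m \<noteq> d * n"
  shows "plethysm (hsym d) (hsym n) m = 0"
proof -
  have "factorizations d n m = {}"
  proof (rule equals0I)
    fix C assume "C \<in> factorizations d n m"
    then have "size C = d" "\<And>x. x \<in># C \<Longrightarrow> size x = n" "\<Sum>\<^sub># C = m"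
      by (auto simp: factorizations_def)
    with size_Sum_mset_const[of C n] assms(2) show False by metis
  qed
  then show ?thesis using assms(1) by (simp add: plethysm_hsym)
qed

section \<open>Setting the variable \<open>x\<^sub>0\<close> to 1\<close>

definition bounded_factorizations :: "nat \<Rightarrow> nat \<Rightarrow> monom \<Rightarrow> monom multiset set" where
  "bounded_factorizations d n w =
     {D. size D \<le> d \<and> (\<forall>x\<in>#D. x \<noteq> {#} \<and> size x \<le> n) \<and> \<Sum>\<^sub># D = w}"

definition drop_zeros :: "monom \<Rightarrow> monom" where
  "drop_zeros m = filter_mset (\<lambda>i. i \<noteq> 0) m"

text \<open>Homogenization to degree \<open>n\<close> by a power of \<open>x\<^sub>0\<close>,
  inverse to \<open>drop_zeros\<close> on monomials of degree \<open>n\<close>.\<close>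

definition pad :: "nat \<Rightarrow> monom \<Rightarrow> monom" where
  "pad n x = x + replicate_mset (n - size x) 0"

lemma pad_drop_zeros:
  assumes "size x = n"
  shows "pad n (drop_zeros x) = x"
proof -
  have x: "x = drop_zeros x + replicate_mset (count x 0) 0"
    by (rule multiset_eqI) (simp add: drop_zeros_def)
  then have "size x = size (drop_zeros x) + count x 0"
    by (metis size_replicate_mset size_union)
  with assms have "n - size (drop_zeros x) = count x 0" by simp
  with x show ?thesis by (simp add: pad_def)
qed

lemma drop_zeros_pad: "0 \<notin># x \<Longrightarrow> drop_zeros (pad n x) = x"
  by (rule multiset_eqI) (auto simp: drop_zeros_def pad_def count_eq_zero_iff)

lemma pad_empty: "pad n {#} = replicate_mset n 0"
  by (simp add: pad_def)

text \<open>Setting \<open>x\<^sub>0\<close> to 1 and deleting constant factors loses nothing: the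
  degree \<open>n\<close> restores the power of \<open>x\<^sub>0\<close> in each factor, and
  \<open>d\<close> restores the number of deleted factors. The size of \<open>m\<close> likewise
  fixes its power of \<open>x\<^sub>0\<close>.\<close>

lemma card_factorizations:
  assumes "size m = d * n"
  shows "card (factorizations d n m) = card (bounded_factorizations d n (drop_zeros m))"
proof -
  let ?w = "drop_zeros m"
  let ?drop = "\<lambda>C. filter_mset (\<lambda>x. x \<noteq> {#}) (image_mset drop_zeros C)"
  let ?pad = "\<lambda>D. image_mset (pad n) D + replicate_mset (d - size D) (replicate_mset n 0)"
  have sum_drop: "\<Sum>\<^sub># (?drop C) = drop_zeros (\<Sum>\<^sub># C)" for C
    by (induction C) (auto simp: drop_zeros_def)
  have drop_in: "?drop C \<in> bounded_factorizations d n ?w" if "C \<in> factorizations d n m" for C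
  proof -
    have "size (drop_zeros x) \<le> size x" for x by (simp add: drop_zeros_def)
    then have "\<forall>x\<in>#?drop C. x \<noteq> {#} \<and> size x \<le> n"
      using that by (fastforce simp: factorizations_def)
    moreover have "size (?drop C) \<le> d"
      using that size_filter_mset_lesseq[of _ "image_mset drop_zeros C"]
      by (simp add: factorizations_def)
    ultimately show ?thesis
      using that sum_drop[of C] by (simp add: bounded_factorizations_def factorizations_def)
  qed
  have pad_drop: "?pad (?drop C) = C" if "C \<in> factorizations d n m" for C
  proof -
    let ?E = "image_mset drop_zeros C"
    have C: "size C = d" "\<And>x. x \<in># C \<Longrightarrow> size x = n"
      using that by (auto simp: factorizations_def)
    have E: "?E = ?drop C + replicate_mset (count ?E {#}) {#}"
      by (rule multiset_eqI) simp
    then have "size ?E = size (?drop C) + count ?E {#}"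
      by (metis size_replicate_mset size_union)
    then have "?E = ?drop C + replicate_mset (d - size (?drop C)) {#}"
      using E C(1) by simp
    then have "image_mset (pad n) ?E =
        image_mset (pad n) (?drop C + replicate_mset (d - size (?drop C)) {#})"
      by (rule arg_cong)
    then have "image_mset (pad n) ?E = ?pad (?drop C)"
      by (simp only: image_mset_union image_replicate_mset pad_empty)
    moreover have "image_mset (pad n) ?E = image_mset id C"
      unfolding multiset.map_comp using C(2) by (intro image_mset_cong) (simp add: pad_drop_zeros)
    ultimately show ?thesis by simp
  qed
  have drop_pad: "?drop (?pad D) = D" and pad_in: "?pad D \<in> factorizations d n m"
    if "D \<in> bounded_factorizations d n ?w" for D
  proof -
    have D: "size D \<le> d" "\<And>x. x \<in># D \<Longrightarrow> x \<noteq> {#} \<and> size x \<le> n" "\<Sum>\<^sub># D = ?w"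
      using that by (auto simp: bounded_factorizations_def)
    have "0 \<notin># \<Sum>\<^sub># D" by (simp add: D(3) drop_zeros_def)
    then have "0 \<notin># x" if "x \<in># D" for x using that by auto
    then have "image_mset drop_zeros (image_mset (pad n) D) = image_mset id D"
      unfolding multiset.map_comp by (intro image_mset_cong) (simp add: drop_zeros_pad)
    moreover have "filter_mset (\<lambda>x. x \<noteq> {#}) D = D"
      using D(2) by (simp add: filter_mset_eq_conv)
    ultimately show *: "?drop (?pad D) = D" by (simp add: drop_zeros_def)
    have size: "size (?pad D) = d" using D(1) by simp
    moreover have n: "size x = n" if "x \<in># ?pad D" for x
      using that D(2) by (auto simp: pad_def split: if_splits)
    moreover have "\<Sum>\<^sub># (?pad D) = m"
    proof -
      have "size (\<Sum>\<^sub># (?pad D)) = d * n" using size_Sum_mset_const[of "?pad D" n] n size by simp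
      moreover have "drop_zeros (\<Sum>\<^sub># (?pad D)) = ?w"
        unfolding sum_drop[symmetric] * by (rule D(3))
      ultimately show ?thesis using assms pad_drop_zeros by metis
    qed
    ultimately show "?pad D \<in> factorizations d n m" unfolding factorizations_def by blast
  qed
  have "bij_betw ?drop (factorizations d n m) (bounded_factorizations d n ?w)"
    by (rule bij_betw_byWitness[where f' = ?pad]) (use drop_in pad_drop drop_pad pad_in in auto)
  then show ?thesis by (rule bij_betw_same_card)
qed

section \<open>Exchanging the two bounds\<close>

text \<open>Each part has size at least 1, so equality of the totals leaves only singletons.\<close>

lemma eq_image_single_if_size_eq:
  fixes D :: "'a multiset multiset"
  assumes "\<And>x. x \<in># D \<Longrightarrow> x \<noteq> {#}" "size D = size (\<Sum>\<^sub># D)"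
  shows "D = image_mset (\<lambda>i. {#i#}) (\<Sum>\<^sub># D)"
  using assms
proof (induction D)
  case (add x D)
  have "1 \<le> size x" using add.prems(1)[of x] by (simp add: Suc_le_eq nonempty_has_size)
  moreover have "size D \<le> size (\<Sum>\<^sub># D)"
    using size_le_size_Sum_mset[of D] add.prems(1) by simp
  ultimately have x: "size x = 1" and D: "size D = size (\<Sum>\<^sub># D)"
    using add.prems(2) by simp_all
  have "D = image_mset (\<lambda>i. {#i#}) (\<Sum>\<^sub># D)" using add.IH D add.prems(1) by simp
  moreover from x obtain i where "x = {#i#}" by (metis One_nat_def size_1_singleton_mset)
  ultimately show ?case by simp
qed simp

lemma Sum_mset_image_single: "\<Sum>\<^sub># (image_mset (\<lambda>i. {#i#}) w) = w"
  by (induction w) auto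

definition one_pair :: "'a multiset \<Rightarrow> 'a multiset \<Rightarrow> 'a multiset multiset" where
  "one_pair w x = add_mset x (image_mset (\<lambda>i. {#i#}) (w - x))"

text \<open>The excess of the part sizes over 1 adds up to one, so a single part has size 2 and the
  others are singletons.\<close>

lemma ex_one_pair_if_size_Suc:
  fixes D :: "'a multiset multiset"
  assumes "\<And>x. x \<in># D \<Longrightarrow> x \<noteq> {#}" "size (\<Sum>\<^sub># D) = Suc (size D)"
  shows "\<exists>x. x \<subseteq># \<Sum>\<^sub># D \<and> size x = 2 \<and> D = one_pair (\<Sum>\<^sub># D) x"
proof -
  have "\<exists>x\<in>#D. size x \<noteq> 1"
    using assms(2) size_Sum_mset_const[of D 1] by fastforce
  then obtain x D' where D: "D = add_mset x D'" "size x \<noteq> 1" by (metis multi_member_split)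
  have "x \<noteq> {#}" using assms(1) D by simp
  then have "2 \<le> size x" using D(2) by (metis One_nat_def Suc_1 le_neq_implies_less Suc_leI nonempty_has_size)
  moreover have "size D' \<le> size (\<Sum>\<^sub># D')"
    using size_le_size_Sum_mset[of D'] assms(1) D by simp
  ultimately have x: "size x = 2" and D': "size D' = size (\<Sum>\<^sub># D')"
    using assms(2) D by simp_all
  have "D' = image_mset (\<lambda>i. {#i#}) (\<Sum>\<^sub># D')"
    using eq_image_single_if_size_eq[OF _ D'] assms(1) D by simp
  then have "D = one_pair (\<Sum>\<^sub># D) x" by (simp add: one_pair_def D(1))
  moreover have "x \<subseteq># \<Sum>\<^sub># D" by (simp add: D(1))
  ultimately show ?thesis using x by blast
qed

text \<open>Each bounded set is the complement in \<open>W\<close> of the extremal set added to it,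
  so both sides equal \<open>card W\<close>.\<close>

lemma card_bounded_factorizations_flip:
  fixes w :: monom
  assumes "1 \<le> n"
  defines "W \<equiv> bounded_factorizations (Suc n) (Suc n) w"
  shows "card (bounded_factorizations (Suc n) n w) + card {D \<in> W. \<exists>x\<in>#D. size x = Suc n} =
    card (bounded_factorizations n (Suc n) w) + card {D \<in> W. size D = Suc n}"
proof -
  have fin: "finite W"
    by (rule finite_subset[OF _ finite_mset_Sum_mset_eq[of w]])
      (auto simp: W_def bounded_factorizations_def)
  have split: "card W = card {D \<in> W. \<not> P D} + card {D \<in> W. P D}" for P
    by (subst card_Un_disjoint[symmetric]) (use fin in \<open>auto intro!: arg_cong[where f = card]\<close>)
  have "bounded_factorizations (Suc n) n w = {D \<in> W. \<not> (\<exists>x\<in>#D. size x = Suc n)}"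
    "bounded_factorizations n (Suc n) w = {D \<in> W. \<not> size D = Suc n}"
    by (auto simp: W_def bounded_factorizations_def le_Suc_eq)
  then show ?thesis
    using split[of "\<lambda>D. \<exists>x\<in>#D. size x = Suc n"] split[of "\<lambda>D. size D = Suc n"] by simp
qed

lemma bounded_factorizations_extremal_empty:
  assumes "size w \<le> n"
  shows "{D \<in> bounded_factorizations d k w. size D = Suc n} = {}"
    "{D \<in> bounded_factorizations d k w. \<exists>x\<in>#D. size x = Suc n} = {}"
proof -
  have "size D \<le> n" "\<forall>x\<in>#D. size x \<le> n" if "D \<in> bounded_factorizations d k w" for D
  proof -
    have D: "\<And>x. x \<in># D \<Longrightarrow> x \<noteq> {#}" "\<Sum>\<^sub># D = w"
      using that by (auto simp: bounded_factorizations_def)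
    show "size D \<le> n" using size_le_size_Sum_mset[of D] D assms by simp
    show "\<forall>x\<in>#D. size x \<le> n"
      using D(2) assms by (auto dest!: multi_member_split)
  qed
  then show "{D \<in> bounded_factorizations d k w. size D = Suc n} = {}"
    "{D \<in> bounded_factorizations d k w. \<exists>x\<in>#D. size x = Suc n} = {}"
    by fastforce+
qed

text \<open>Each bound is attained once: by the factorization into single variables, and by
  \<open>w\<close> as its own only factor.\<close>

lemma bounded_factorizations_extremal_Suc:
  assumes "size w = Suc n"
  shows "{D \<in> bounded_factorizations (Suc n) (Suc n) w. size D = Suc n} = {image_mset (\<lambda>i. {#i#}) w}"
    "{D \<in> bounded_factorizations (Suc n) (Suc n) w. \<exists>x\<in>#D. size x = Suc n} = {{#w#}}"
proof -
  have "D = image_mset (\<lambda>i. {#i#}) w"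
    if "D \<in> bounded_factorizations (Suc n) (Suc n) w" "size D = Suc n" for D
    using that eq_image_single_if_size_eq[of D] assms by (auto simp: bounded_factorizations_def)
  moreover have "image_mset (\<lambda>i. {#i#}) w \<in> bounded_factorizations (Suc n) (Suc n) w"
    using assms by (auto simp: bounded_factorizations_def Sum_mset_image_single)
  moreover have "size (image_mset (\<lambda>i. {#i#}) w) = Suc n" using assms by simp
  ultimately show "{D \<in> bounded_factorizations (Suc n) (Suc n) w. size D = Suc n} =
      {image_mset (\<lambda>i. {#i#}) w}"
    by blast
  have "D = {#w#}"
    if D: "D \<in> bounded_factorizations (Suc n) (Suc n) w" "x \<in># D" "size x = Suc n" for D x
  proof -
    obtain D' where D': "D = add_mset x D'" using D(2) by (metis multi_member_split)
    have "size (\<Sum>\<^sub># D') = 0" "size D' \<le> size (\<Sum>\<^sub># D')"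
      using D assms size_le_size_Sum_mset[of D'] by (auto simp: bounded_factorizations_def D')
    then have "D' = {#}" by (metis le_zero_eq size_eq_0_iff_empty)
    then show ?thesis using D by (simp add: bounded_factorizations_def D')
  qed
  moreover have "{#w#} \<in> bounded_factorizations (Suc n) (Suc n) w"
    using assms by (auto simp: bounded_factorizations_def)
  moreover have "\<exists>x\<in>#{#w#}. size x = Suc n" using assms by simp
  ultimately show "{D \<in> bounded_factorizations (Suc n) (Suc n) w. \<exists>x\<in>#D. size x = Suc n} = {{#w#}}"
    by blast
qed

text \<open>Such a \<open>D\<close> consists of a quadratic divisor of \<open>w\<close> and single
  variables, and the divisor is recovered as its only part of size 2. The condition
  \<open>1 \<le> n\<close> makes a part of this size admissible.\<close>

lemma card_bounded_factorizations_many_parts: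
  assumes w: "size w = Suc (Suc n)" and n: "1 \<le> n"
  shows "card {D \<in> bounded_factorizations (Suc n) (Suc n) w. size D = Suc n} =
    card {x. x \<subseteq># w \<and> size x = 2}"
proof -
  have sum: "\<Sum>\<^sub># (one_pair w x) = w" if "x \<subseteq># w" for x
    using that by (simp add: one_pair_def Sum_mset_image_single)
  have "filter_mset (\<lambda>y. size y = 2) (one_pair w x) = {#x#}" if "size x = 2" for x
    using that by (auto simp: one_pair_def)
  then have inj: "inj_on (one_pair w) {x. x \<subseteq># w \<and> size x = 2}"
    by (metis (mono_tags, lifting) inj_onI mem_Collect_eq single_eq_single)
  have "one_pair w ` {x. x \<subseteq># w \<and> size x = 2} =
      {D \<in> bounded_factorizations (Suc n) (Suc n) w. size D = Suc n}"
  proof (intro equalityI subsetI)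
    fix D assume "D \<in> one_pair w ` {x. x \<subseteq># w \<and> size x = 2}"
    then obtain x where x: "x \<subseteq># w" "size x = 2" "D = one_pair w x" by blast
    then have "x \<noteq> {#}" by auto
    then show "D \<in> {D \<in> bounded_factorizations (Suc n) (Suc n) w. size D = Suc n}"
      using x sum[of x] w n
      by (auto simp: bounded_factorizations_def one_pair_def size_Diff_submset)
  next
    fix D assume "D \<in> {D \<in> bounded_factorizations (Suc n) (Suc n) w. size D = Suc n}"
    then have "\<And>x. x \<in># D \<Longrightarrow> x \<noteq> {#}" "\<Sum>\<^sub># D = w" "size D = Suc n"
      by (auto simp: bounded_factorizations_def)
    then show "D \<in> one_pair w ` {x. x \<subseteq># w \<and> size x = 2}"
      using ex_one_pair_if_size_Suc[of D] w by auto
  qed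
  then show ?thesis using card_image[OF inj] by simp
qed

text \<open>A part of size \<open>Suc n\<close> leaves a cofactor of size 1, so \<open>D\<close>
  corresponds to a variable dividing \<open>w\<close>. By \<open>1 \<le> n\<close> the long part is
  not a single variable, so that variable can be read off from \<open>D\<close>.\<close>

lemma card_bounded_factorizations_long_part:
  assumes w: "size w = Suc (Suc n)" and n: "1 \<le> n"
  shows "card {D \<in> bounded_factorizations (Suc n) (Suc n) w. \<exists>x\<in>#D. size x = Suc n} =
    card (set_mset w)"
proof -
  let ?f = "\<lambda>i. {#{#i#}, w - {#i#}#}"
  have "filter_mset (\<lambda>y. size y = 1) (?f i) = {#{#i#}#}" if "i \<in># w" for i
    using that w n by (simp add: size_Diff_singleton)
  then have inj: "inj_on ?f (set_mset w)"
    by (metis (mono_tags, lifting) inj_onI single_eq_single)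
  have "?f ` set_mset w =
      {D \<in> bounded_factorizations (Suc n) (Suc n) w. \<exists>x\<in>#D. size x = Suc n}"
  proof (intro equalityI subsetI)
    fix D assume "D \<in> ?f ` set_mset w"
    then obtain i where i: "i \<in># w" "D = ?f i" by blast
    have "size (w - {#i#}) = Suc n" using i(1) w by (simp add: size_Diff_singleton)
    moreover from this have "w - {#i#} \<noteq> {#}" by auto
    ultimately show "D \<in> {D \<in> bounded_factorizations (Suc n) (Suc n) w. \<exists>x\<in>#D. size x = Suc n}"
      using i n by (auto simp: bounded_factorizations_def)
  next
    fix D assume "D \<in> {D \<in> bounded_factorizations (Suc n) (Suc n) w. \<exists>x\<in>#D. size x = Suc n}"
    then obtain x where D: "\<And>x. x \<in># D \<Longrightarrow> x \<noteq> {#}" "\<Sum>\<^sub># D = w" "x \<in># D" "size x = Suc n"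
      by (auto simp: bounded_factorizations_def)
    then obtain D' where D': "D = add_mset x D'" by (metis multi_member_split)
    have s: "size (\<Sum>\<^sub># D') = 1" using D(2,4) w by (auto simp: D')
    then obtain i where i: "\<Sum>\<^sub># D' = {#i#}" by (metis One_nat_def size_1_singleton_mset)
    have "size D' \<le> 1" using size_le_size_Sum_mset[of D'] D(1) s by (simp add: D')
    moreover have "D' \<noteq> {#}" using i by auto
    then have "size D' \<noteq> 0" by simp
    ultimately have "size D' = size (\<Sum>\<^sub># D')" using s by linarith
    then have "D' = {#{#i#}#}"
      using eq_image_single_if_size_eq[of D'] D(1) i by (simp add: D')
    moreover have "w = x + {#i#}" using D(2) i by (simp add: D')
    ultimately show "D \<in> ?f ` set_mset w" by (auto simp: D' add_mset_commute)
  qed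
  then show ?thesis using card_image[OF inj] by simp
qed

section \<open>Divisors of monomials in two variables\<close>

abbreviation word :: "nat \<Rightarrow> nat \<Rightarrow> monom" where
  "word p q \<equiv> replicate_mset p 1 + replicate_mset q 2"

lemma subset_word_size_2:
  "{x. x \<subseteq># word p q \<and> size x = 2} =
    (\<lambda>i. word i (2 - i)) ` {i. i \<le> 2 \<and> i \<le> p \<and> 2 - i \<le> q}"
proof (intro equalityI subsetI)
  fix x assume "x \<in> {x. x \<subseteq># word p q \<and> size x = 2}"
  then have x: "x \<subseteq># word p q" "size x = 2" by auto
  have le: "count x j \<le> count (word p q) j" for j using x(1) by (rule mset_subset_eq_count)
  have eq: "x = word (count x 1) (count x 2)"
  proof (rule multiset_eqI)
    fix j show "count x j = count (word (count x 1) (count x 2)) j"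
      using le[of j] by (cases "j = 1"; cases "j = 2") auto
  qed
  then have "count x 1 + count x 2 = 2"
    using x(2) by (metis size_replicate_mset size_union)
  then have "count x 2 = 2 - count x 1" "count x 1 \<le> 2" by simp_all
  moreover have "count x 1 \<le> p" "count x 2 \<le> q" using le[of 1] le[of 2] by simp_all
  ultimately show "x \<in> (\<lambda>i. word i (2 - i)) ` {i. i \<le> 2 \<and> i \<le> p \<and> 2 - i \<le> q}"
    using eq by (intro image_eqI[where x = "count x 1"]) auto
qed (auto simp: subseteq_mset_def)

lemma card_subset_word_size_2:
  "card {x. x \<subseteq># word p q \<and> size x = 2} = card {i. i \<le> 2 \<and> i \<le> p \<and> 2 - i \<le> q}"
proof -
  have "inj (\<lambda>i. word i (2 - i))"
  proof (rule injI)
    fix i j assume "word i (2 - i) = word j (2 - j)"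
    then have "count (word i (2 - i)) 1 = count (word j (2 - j)) 1" by simp
    then show "i = j" by simp
  qed
  then show ?thesis unfolding subset_word_size_2 by (intro card_image) (auto intro: inj_on_subset)
qed

lemma drop_zeros_content_three: "drop_zeros (content [a, p, q]) = word p q"
  by (rule multiset_eqI) (auto simp: drop_zeros_def row_three)

text \<open>After \<open>x\<^sub>0\<close> is set to 1,
  \<open>card_bounded_factorizations_flip\<close> reduces the difference to the two extremal counts,
  which agree for \<open>p + q \<le> n + 1\<close>.\<close>

lemma plethysm_hsym_diff:
  assumes "1 \<le> n" "a + p + q = n * (n + 1)" "p + q \<le> n + 2"
  shows "plethysm (hsym (n + 1)) (hsym n) (content [a, p, q]) -
      plethysm (hsym n) (hsym (n + 1)) (content [a, p, q]) =
    (if p + q = n + 2 then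
       int (card {i. i \<le> 2 \<and> i \<le> p \<and> 2 - i \<le> q}) - int (card (set_mset (word p q))) else 0)"
proof -
  let ?w = "word p q"
  let ?W = "bounded_factorizations (Suc n) (Suc n) ?w"
  have "plethysm (hsym (n + 1)) (hsym n) (content [a, p, q]) =
      int (card (bounded_factorizations (Suc n) n ?w))"
    using assms by (simp add: plethysm_hsym card_factorizations drop_zeros_content_three algebra_simps)
  moreover have "plethysm (hsym n) (hsym (n + 1)) (content [a, p, q]) =
      int (card (bounded_factorizations n (Suc n) ?w))"
    using assms by (simp add: plethysm_hsym card_factorizations drop_zeros_content_three algebra_simps)
  ultimately have "plethysm (hsym (n + 1)) (hsym n) (content [a, p, q]) -
      plethysm (hsym n) (hsym (n + 1)) (content [a, p, q]) =
      int (card {D \<in> ?W. size D = Suc n}) - int (card {D \<in> ?W. \<exists>x\<in>#D. size x = Suc n})"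
    using card_bounded_factorizations_flip[OF assms(1), of ?w] by linarith
  moreover have "size ?w \<le> n \<or> size ?w = Suc n \<or> size ?w = Suc (Suc n)" using assms(3) by auto
  moreover have "int (card {D \<in> ?W. size D = Suc n}) - int (card {D \<in> ?W. \<exists>x\<in>#D. size x = Suc n}) = 0"
    if "size ?w \<le> n"
    unfolding bounded_factorizations_extremal_empty[OF that] by simp
  moreover have "int (card {D \<in> ?W. size D = Suc n}) - int (card {D \<in> ?W. \<exists>x\<in>#D. size x = Suc n}) = 0"
    if "size ?w = Suc n"
    unfolding bounded_factorizations_extremal_Suc[OF that] by simp
  moreover have "int (card {D \<in> ?W. size D = Suc n}) - int (card {D \<in> ?W. \<exists>x\<in>#D. size x = Suc n}) =
      int (card {i. i \<le> 2 \<and> i \<le> p \<and> 2 - i \<le> q}) - int (card (set_mset ?w))"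
    if "size ?w = Suc (Suc n)"
    using card_bounded_factorizations_many_parts[OF that assms(1)]
      card_bounded_factorizations_long_part[OF that assms(1)] card_subset_word_size_2[of p q] by simp
  ultimately show ?thesis by auto
qed

section \<open>Evaluation of the alternating sums\<close>

lemma plethysm_coeff_three:
  assumes "1 \<le> n" "q \<le> p" "r \<le> q" "2 \<le> r"
  shows "plethysm_coeff [p, q, r] d n = alternating_sum (plethysm (hsym d) (hsym n)) p q r"
proof -
  let ?f = "plethysm (hsym d) (hsym n)"
  have "schur_expansion ?f (schur_coeff ?f)"
    using swap_invariant_plethysm_hsym plethysm_hsym_homogeneous assms(1)
    by (intro schur_expansion_schur_coeff[where N = "d * n"]) auto
  then show ?thesis unfolding plethysm_coeff_def using assms(2-4) by (rule schur_coeff_three)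
qed

theorem theorem5:
  fixes n :: nat
  assumes "n \<ge> 2"
  shows "plethysm_coeff [n^2 - 2, n, 2] (n + 1) n = 1 + plethysm_coeff [n^2 - 2, n, 2] n (n + 1)"
proof -
  define p where "p = n\<^sup>2 - 2"
  have "2 * n \<le> n\<^sup>2" using assms by (simp add: power2_eq_square)
  then have p: "n\<^sup>2 = p + 2" and np: "n \<le> p" using assms by (simp_all add: p_def)
  have N: "n * (n + 1) = p + n + 2" using p by (simp add: power2_eq_square)
  let ?f = "plethysm (hsym (n + 1)) (hsym n)" and ?g = "plethysm (hsym n) (hsym (n + 1))"
  \<comment> \<open>This covers the four terms of the alternating sum other than
    \<open>[p, n, 2]\<close> and \<open>[p, n + 1, 1]\<close>.\<close>
  have eq: "?f (content [a, b, c]) = ?g (content [a, b, c])"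
    if "a + b + c = p + n + 2" "b + c \<le> n + 1" for a b c
    using plethysm_hsym_diff[of n a b c] that N assms by simp
  \<comment> \<open>All three quadratic monomials divide the word, against two variables: the source
    of the summand 1.\<close>
  have "{i. i \<le> 2 \<and> i \<le> n \<and> 2 - i \<le> 2} = {..2}" using assms by auto
  then have 1: "?f (content [p, n, 2]) = ?g (content [p, n, 2]) + 1"
    using plethysm_hsym_diff[of n p n 2] N assms by simp
  \<comment> \<open>The square of \<open>x\<^sub>2\<close> does not divide this word, so two
    quadratic divisors stand against two variables.\<close>
  have "{i. i \<le> 2 \<and> i \<le> n + 1 \<and> 2 - i \<le> 1} = {1..2}" using assms by auto
  then have 2: "?f (content [p, n + 1, 1]) = ?g (content [p, n + 1, 1])"
    using plethysm_hsym_diff[of n p "n + 1" 1] N assms by simp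
  have "alternating_sum ?f p n 2 = 1 + alternating_sum ?g p n 2"
    unfolding alternating_sum_def using 1 2 assms eq by simp
  then show ?thesis using assms np p by (simp add: plethysm_coeff_three)
qed

end
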